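(* Let $C$ be a while-program and suppose that the compilation judgement $\{\},\epsilon\vdash C\hookrightarrow P,\langle w,t\rangle,l,\Phi$ is derivable (starting from the empty register record $\{\}$ and the empty label $\epsilon$). Then the RISC program $P$ enjoys PoNI (possibilistic fault-tolerant non-interference).
   Context: **RISC machine.** $\mathbb W$ is the set of machine words (bit strings of a fixed width, identified with numbers), $\mathit{Reg}$ a set of register names, $\mathit{Lab}$ a set of labels. A register bank is $\mathsf R:\mathit{Reg}\to\mathbb W$, a data memory is $\mathcal M:\mathbb W\to\mathbb W$. A RISC program (code memory) $P$ is a finite list of instructions, positions numbered from $0$, each of the form $B$ or $l:B$ ($l\in\mathit{Lab}$), no label occurring twice, with $B::=\mathsf{load}\ r\ k\mid\mathsf{store}\ k\ r\mid\mathsf{jmp}\ l\mid\mathsf{jz}\ l\ r\mid\mathsf{nop}\mid\mathsf{movek}\ r\ k\mid\mathsf{mover}\ r\ r'\mid\mathsf{op}\ r\ r'\mid\mathsf{out}\ ch\ r$, where $k\in\mathbb W$, $ch\in\{\mathit{low},\mathit{high}\}$, and $\mathsf{op}$ is a binary operator on $\mathbb W$. $\mathrm{res}_P(l)$ is the position of label $l$ in $P$ (undefined if $l$ does not label an instruction of $P$). States are $\langle P,pc,\mathsf R,\mathcal M\rangle$ with $pc\in\mathbb W$ (programs are short enough that positions and their successors are in $\mathbb W$). According to the instruction $P(pc)$, there is a single transition, which leaves $P$ unchanged, has label $\tau$ except for $\mathsf{out}$, and moves $pc$ to $pc+1$ unless stated otherwise: $\mathsf{load}\ r\ k$ sets $\mathsf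 R(r):=\mathcal M(k)$; $\mathsf{store}\ k\ r$ sets $\mathcal M(k):=\mathsf R(r)$; $\mathsf{jmp}\ l$ sets $pc:=\mathrm{res}_P(l)$; $\mathsf{jz}\ l\ r$ sets $pc:=\mathrm{res}_P(l)$ if $\mathsf R(r)=0$ and otherwise only increments $pc$; $\mathsf{nop}$ does nothing; $\mathsf{movek}\ r\ k$ sets $\mathsf R(r):=k$; $\mathsf{mover}\ r\ r'$ sets $\mathsf R(r):=\mathsf R(r')$; $\mathsf{op}\ r\ r'$ sets $\mathsf R(r):=\mathsf R(r)\ \mathsf{op}\ \mathsf R(r')$; $\mathsf{out}\ ch\ r$ has label $ch!\mathsf R(r)$ and changes nothing else. There is no transition if $P(pc)$ is undefined or the required $\mathrm{res}_P(l)$ is undefined (the state is stuck). **Security levels.** $\mathit{Var}$ is the set of while-variables, $v2p:\mathit{Var}\to\mathbb W$ an injective map. $\mathrm{level}:\mathit{Var}\cup\mathit{Reg}\to\{L,H\}$ is given, with order $L\sqsubseteq H$; channels have $\mathrm{level}(\mathit{low})=L$, $\mathrm{level}(\mathit{high})=H$. $(\mathsf R,\mathcal M)=_{\mathsf L}(\mathsf R',\mathcal M')$ means $\mathsf R(r)=\mathsf R'(r)$ for all $r$ with $\mathrm{level}(r)=L$ and $\mathcal M(v2p(x))=\mathcal M'(v2p(x))$ for all $x$ with $\mathrm{level}(x)=L$ (all other registers and memory cells are regarded as high). $\mathrm{low}(\mathit{low}!k)=\mathit{low}!k$, and $\mathrm{low}(a)=\tau$ for every other action. **PoNI of a RISC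 program.** The faulty locations $F$ are the individual bits of the registers in $\mathit{Reg}$ and of the data memory cells; the code memory and the program counter are fault-tolerant. For $L\subseteq F$ and a state $s$, $\mathrm{flip}(s,L)$ negates exactly the bits in $L$. The augmented transition relation $\to_+$, with labels $(L,a)$, $L\subseteq F$, is: (i) if $s$ is not stuck and $\mathrm{flip}(s,L)\xrightarrow{a}s'$, then $s\xrightarrow{L,a}_+s'$; (ii) if $s$ is not stuck but $\mathrm{flip}(s,L)$ is stuck, then $s\xrightarrow{L,\tau}_+\mathrm{flip}(s,L)$; (iii) if $s$ is stuck, then $s\xrightarrow{L,\tau}_+s$ for every $L\subseteq F$. A run $s\xrightarrow{L_0,a_0}_+\cdots\xrightarrow{L_{n-1},a_{n-1}}_+s_n$ has trace $L_0,\mathrm{low}(a_0),\dots,L_{n-1},\mathrm{low}(a_{n-1})$; write $s\Rightarrow^t$ if some finite run from $s$ has trace $t$. $P$ enjoys PoNI if for all $(\mathsf R,\mathcal M)=_{\mathsf L}(\mathsf R',\mathcal M')$ and all traces $t$: $\langle P,0,\mathsf R,\mathcal M\rangle\Rightarrow^t$ iff $\langle P,0,\mathsf R',\mathcal M'\rangle\Rightarrow^t$. **While-programs.** $C::=\mathsf{skip}\mid x:=E\mid\mathsf{if}\ E\ \mathsf{then}\ C_1\ \mathsf{else}\ C_2\mid\mathsf{out}\ ch\ E\mid C_1;C_2\mid\mathsf{while}\ x\ \mathsf{do}\ C$, with $E::=k\in\mathbb W\mid x\in\mathit{Var}\mid E_1\ \mathsf{op}\ E_2$. **Register records.** A register record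 $\Phi$ is a partial injective function $\mathit{Reg}\rightharpoonup\mathit{Var}$. $\Phi[r\not\to]$ removes any association of $r$. $\Phi[r\leftrightarrow x]$ removes any association of $r$ and any association of $x$, then associates $r$ with $x$. $\Phi\sqcap\Phi'$ is the set of associations common to both; $\Phi\sqsubseteq\Phi'$ is inclusion of associations. **Code conventions.** $\epsilon$ is the empty label ($\epsilon:B$ is $B$). $\iota$ is the empty instruction: $[l:\iota]\mathbin{+\!\!+}[B,I_1,\dots]=[l:B,I_1,\dots]$, and an unlabelled $\iota$ may be erased. $l:P$ attaches $l$ to the first instruction of $P$. $\mathsf{nop}^m$ is $m$ consecutive $\mathsf{nop}$'s if $m>0$ and $\iota$ otherwise. $\mathbin{+\!\!+}$ is concatenation, required to yield a program without duplicate labels. "Fresh" labels do not occur elsewhere. **Annotations.** Write effects: $\mathsf{Wr}\,H\sqsubseteq\mathsf{Wr}\,L$, with join $\sqcup$. Timings: $\mathsf{Trm}\,0\sqsubseteq\mathsf{Trm}\,1\sqsubseteq\dots\sqsubseteq\mathsf{Trm}\,L\sqsubseteq\mathsf{Trm}\,H$. $t_1\veebar t_2=\mathsf{Trm}\,L$ if $t_1,t_2\sqsubseteq\mathsf{Trm}\,L$, else $\mathsf{Trm}\,H$. $t_1\uplus t_2=\mathsf{Trm}\,(n_1+n_2)$ if $t_i=\mathsf{Trm}\,n_i$ with $n_i\in\mathbb N$ for $i=1,2$, else $t_1\veebar t_2$. $\mathrm{write}(H)=\mathsf{Wr}\,H$, $\mathrm{write}(L)=\mathsf{Wr}\,L$,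 $\mathrm{term}(L)=\mathsf{Trm}\,L$, $\mathrm{term}(H)=\mathsf{Trm}\,H$. **Expression rules** $\Phi,A,l\Vdash E\hookrightarrow P,\langle\lambda,n\rangle,r,\Phi'$ ($A\subseteq\mathit{Reg}$): - (K) if $r\notin A$: $\Phi,A,l\Vdash k\hookrightarrow[l:\mathsf{movek}\ r\ k],\langle\mathrm{level}(r),1\rangle,r,\Phi[r\not\to]$. - (V-cached) if $\Phi(r)=x$: $\Phi,A,l\Vdash x\hookrightarrow[l:\iota],\langle\mathrm{level}(r),0\rangle,r,\Phi$. - (V-uncached) if $r\notin A$ and $\mathrm{level}(x)\sqsubseteq\mathrm{level}(r)$: $\Phi,A,l\Vdash x\hookrightarrow[l:\mathsf{load}\ r\ v2p(x)],\langle\mathrm{level}(r),1\rangle,r,\Phi[r\leftrightarrow x]$. - (C) if $\Phi,A,l\Vdash E_1\hookrightarrow P_1,\langle\lambda,n_1\rangle,r,\Phi_1$ and $\Phi_1,A\cup\{r\},\epsilon\Vdash E_2\hookrightarrow P_2,\langle\lambda,n_2\rangle,r',\Phi_2$, then $\Phi,A,l\Vdash E_1\ \mathsf{op}\ E_2\hookrightarrow P_1\mathbin{+\!\!+}P_2\mathbin{+\!\!+}[\mathsf{op}\ r\ r'],\langle\lambda,n_1+n_2+1\rangle,r,\Phi_2[r\not\to]$. **Command rules** $\Phi,l\vdash C\hookrightarrow P,\langle w,t\rangle,l',\Phi'$: - (skip) $\Phi,l\vdash\mathsf{skip}\hookrightarrow[l:\mathsf{nop}],\langle\mathsf{Wr}\,H,\mathsf{Trm}\,1\rangle,\epsilon,\Phi$.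 - (:=) if $\Phi,\emptyset,l\Vdash E\hookrightarrow P,\langle\mathrm{level}(x),n\rangle,r,\Phi'$, then $\Phi,l\vdash x:=E\hookrightarrow P\mathbin{+\!\!+}[\mathsf{store}\ v2p(x)\ r],tp,\epsilon,\Phi'[r\leftrightarrow x]$, where $tp=\langle\mathsf{Wr}\,H,\mathsf{Trm}\,(n+1)\rangle$ if $\mathrm{level}(x)=H$ and $tp=\langle\mathsf{Wr}\,L,\mathsf{Trm}\,L\rangle$ otherwise. - (out) if $\Phi,\emptyset,l\Vdash E\hookrightarrow P,\langle\mathrm{level}(ch),n\rangle,r,\Phi'$, then $\Phi,l\vdash\mathsf{out}\ ch\ E\hookrightarrow P\mathbin{+\!\!+}[\mathsf{out}\ ch\ r],tp,\epsilon,\Phi'$, where $tp=\langle\mathsf{Wr}\,H,\mathsf{Trm}\,(n+1)\rangle$ if $\mathrm{level}(ch)=H$ and $\langle\mathsf{Wr}\,L,\mathsf{Trm}\,L\rangle$ otherwise. - (if-any) if $\Phi,\emptyset,l\Vdash E\hookrightarrow P_0,\langle\lambda,n_0\rangle,r,\Phi_1$; $\Phi_1,\epsilon\vdash C_i\hookrightarrow P_i,\langle w_i,t_i\rangle,l_i,\Phi_{i+1}$ and $w_i\sqsubseteq\mathrm{write}(\lambda)$ for $i=1,2$; $br,ex$ fresh; then $\Phi,l\vdash\mathsf{if}\ E\ \mathsf{then}\ C_1\ \mathsf{else}\ C_2\hookrightarrow P_0\mathbin{+\!\!+}[\mathsf{jz}\ br\ r]\mathbin{+\!\!+}P_1\mathbin{+\!\!+}[l_1:\mathsf{jmp}\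 ex]\mathbin{+\!\!+}br:P_2\mathbin{+\!\!+}[l_2:\mathsf{nop}],\ \langle\mathrm{write}(\lambda),\mathrm{term}(\lambda)\veebar t_1\veebar t_2\rangle,ex,\Phi_2\sqcap\Phi_3$. - (if-H) if $\Phi,\emptyset,l\Vdash E\hookrightarrow P_0,\langle H,n_0\rangle,r,\Phi_1$; $\Phi_1,\epsilon\vdash C_i\hookrightarrow P_i,\langle\mathsf{Wr}\,H,\mathsf{Trm}\,n_i\rangle,l_i,\Phi_{i+1}$ ($n_i\in\mathbb N$) for $i=1,2$; $m=n_0+\max(n_1,n_2)+2$; $br,ex$ fresh; then $\Phi,l\vdash\mathsf{if}\ E\ \mathsf{then}\ C_1\ \mathsf{else}\ C_2\hookrightarrow P_0\mathbin{+\!\!+}[\mathsf{jz}\ br\ r]\mathbin{+\!\!+}P_1\mathbin{+\!\!+}l_1:\mathsf{nop}^{n_2-n_1}\mathbin{+\!\!+}[\mathsf{jmp}\ ex]\mathbin{+\!\!+}br:P_2\mathbin{+\!\!+}l_2:\mathsf{nop}^{n_1-n_2}\mathbin{+\!\!+}[\mathsf{nop}],\ \langle\mathsf{Wr}\,H,\mathsf{Trm}\,m\rangle,ex,\Phi_2\sqcap\Phi_3$. - (seq) if $\Phi,l\vdash C_1\hookrightarrow P_1,\langle w_1,t_1\rangle,l_1,\Phi_1$; $\Phi_1,l_1\vdash C_2\hookrightarrow P_2,\langle w_2,t_2\rangle,l_2,\Phi_2$; and $t_1=\mathsf{Trm}\,H$ implies $w_2=\mathsf{Wr}\,H$; then $\Phi,l\vdash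 C_1;C_2\hookrightarrow P_1\mathbin{+\!\!+}P_2,\langle w_1\sqcup w_2,t_1\uplus t_2\rangle,l_2,\Phi_2$. - (while) if $\lambda=\mathrm{level}(x)=\mathrm{level}(r)$; $\Phi_B\sqsubseteq\Phi[r\leftrightarrow x]$; $\Phi_B\sqsubseteq\Phi_E[r\leftrightarrow x]$; $\Phi_B,\epsilon\vdash C\hookrightarrow P,\langle w,t\rangle,l',\Phi_E$; $w\sqsubseteq\mathrm{write}(\lambda)$; $t=\mathsf{Trm}\,H$ implies $\mathrm{write}(\lambda)=\mathsf{Wr}\,H$; $P_i=[\mathsf{load}\ r\ v2p(x),\ \mathsf{store}\ v2p(x)\ r]$; $lp,ex$ fresh; then $\Phi,l\vdash\mathsf{while}\ x\ \mathsf{do}\ C\hookrightarrow l:P_i\mathbin{+\!\!+}[lp:\mathsf{jz}\ ex\ r]\mathbin{+\!\!+}P\mathbin{+\!\!+}l':P_i\mathbin{+\!\!+}[\mathsf{jmp}\ lp],\ \langle\mathrm{write}(\lambda),\mathrm{term}(\lambda)\veebar t\rangle,ex,\Phi_B$. *)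

theory Defs
  imports "HOL-Library.Word"
begin

section \<open>RISC machine\<close>

datatype channel = Ch_Low | Ch_High

datatype 'k action = Tau | Out channel 'k

text \<open>
  \<^verbatim>\<open>'r\<close> are registers, \<^verbatim>\<open>'l\<close> labels and \<^verbatim>\<open>'k\<close> machine words (always \<^verbatim>\<open>'w word\<close> below).
  A binary operator is represented by the function on words that it denotes.
\<close>

datatype ('r, 'l, 'k) instr =
    Load 'r 'k
  | Store 'k 'r
  | Jmp 'l
  | Jz 'l 'r
  | Nop
  | Movek 'r 'k
  | Mover 'r 'r
  | Op "'k \<Rightarrow> 'k \<Rightarrow> 'k" 'r 'r
  | Output channel 'r

text \<open>The label \<^term>\<open>None\<close> is the empty label.\<close>

type_synonym ('r, 'l, 'k) program = "('l option \<times> ('r, 'l, 'k) instr) list"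

definition labels :: "('l option \<times> 'i) list \<Rightarrow> 'l list" where
  "labels P = List.map_filter fst P"

definition distinct_labels :: "('l option \<times> 'i) list \<Rightarrow> bool" where
  "distinct_labels P \<longleftrightarrow> distinct (labels P)"

type_synonym ('r, 'w) regs = "'r \<Rightarrow> 'w word"
type_synonym 'w mem = "'w word \<Rightarrow> 'w word"

text \<open>
  A state is a triple of program counter, register bank and data memory; the code memory, which
  never changes, is a parameter of the transition relations.
\<close>

type_synonym ('r, 'w) state = "'w word \<times> ('r, 'w) regs \<times> 'w mem"

definition fetch :: "('r, 'l, 'w::len word) program \<Rightarrow> 'w word \<Rightarrow> ('r, 'l, 'w word) instr option" where
  "fetch P pc = (if unat pc < length P then Some (snd (P ! unat pc)) else None)"

definition res :: "('r, 'l, 'w::len word) program \<Rightarrow> 'l \<Rightarrow> 'w word option" where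
  "res P l =
    (if \<exists>i<length P. fst (P ! i) = Some l
     then Some (word_of_nat (LEAST i. i < length P \<and> fst (P ! i) = Some l))
     else None)"

inductive step ::
  "('r, 'l, 'w::len word) program \<Rightarrow> ('r, 'w) state \<Rightarrow> 'w word action \<Rightarrow> ('r, 'w) state \<Rightarrow> bool"
  for P where
  load: "fetch P pc = Some (Load r k) \<Longrightarrow> step P (pc, R, M) Tau (pc + 1, R(r := M k), M)"
| store: "fetch P pc = Some (Store k r) \<Longrightarrow> step P (pc, R, M) Tau (pc + 1, R, M(k := R r))"
| jmp: "fetch P pc = Some (Jmp l) \<Longrightarrow> res P l = Some pc' \<Longrightarrow> step P (pc, R, M) Tau (pc', R, M)"
| jz_taken: "fetch P pc = Some (Jz l r) \<Longrightarrow> R r = 0 \<Longrightarrow> res P l = Some pc' \<Longrightarrow>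
    step P (pc, R, M) Tau (pc', R, M)"
| jz_not_taken: "fetch P pc = Some (Jz l r) \<Longrightarrow> R r \<noteq> 0 \<Longrightarrow>
    step P (pc, R, M) Tau (pc + 1, R, M)"
| nop: "fetch P pc = Some Nop \<Longrightarrow> step P (pc, R, M) Tau (pc + 1, R, M)"
| movek: "fetch P pc = Some (Movek r k) \<Longrightarrow> step P (pc, R, M) Tau (pc + 1, R(r := k), M)"
| mover: "fetch P pc = Some (Mover r r') \<Longrightarrow> step P (pc, R, M) Tau (pc + 1, R(r := R r'), M)"
| bin_op: "fetch P pc = Some (Op f r r') \<Longrightarrow>
    step P (pc, R, M) Tau (pc + 1, R(r := f (R r) (R r')), M)"
| out: "fetch P pc = Some (Output ch r) \<Longrightarrow>
    step P (pc, R, M) (Out ch (R r)) (pc + 1, R, M)"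

definition stuck :: "('r, 'l, 'w::len word) program \<Rightarrow> ('r, 'w) state \<Rightarrow> bool" where
  "stuck P s \<longleftrightarrow> (\<nexists>a s'. step P s a s')"


section \<open>Security levels\<close>

datatype level = Lo | Hi

instantiation level :: linorder
begin

definition less_eq_level :: "level \<Rightarrow> level \<Rightarrow> bool" where
  "a \<le> b \<longleftrightarrow> a = Lo \<or> b = Hi"

definition less_level :: "level \<Rightarrow> level \<Rightarrow> bool" where
  "a < b \<longleftrightarrow> a = Lo \<and> b = Hi"

instance
proof
  fix a b c :: level
  show "a < b \<longleftrightarrow> a \<le> b \<and> \<not> b \<le> a"
    by (cases a; cases b; simp add: less_eq_level_def less_level_def)
  show "a \<le> a"
    by (cases a; simp add: less_eq_level_def)
  show "a \<le> b \<Longrightarrow> b \<le> c \<Longrightarrow> a \<le> c"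
    by (cases a; cases b; cases c; simp add: less_eq_level_def)
  show "a \<le> b \<Longrightarrow> b \<le> a \<Longrightarrow> a = b"
    by (cases a; cases b; simp add: less_eq_level_def)
  show "a \<le> b \<or> b \<le> a"
    by (cases a; cases b; simp add: less_eq_level_def)
qed

end

fun ch_level :: "channel \<Rightarrow> level" where
  "ch_level Ch_Low = Lo"
| "ch_level Ch_High = Hi"

text \<open>
  Throughout, \<^verbatim>\<open>v2p\<close> maps variables to their addresses, and \<^verbatim>\<open>vlev\<close> and \<^verbatim>\<open>rlev\<close> are the
  restrictions of the level assignment to variables and to registers.
\<close>

definition low_eq ::
  "('v \<Rightarrow> 'w word) \<Rightarrow> ('v \<Rightarrow> level) \<Rightarrow> ('r \<Rightarrow> level) \<Rightarrow>
   ('r, 'w) regs \<times> 'w mem \<Rightarrow> ('r, 'w) regs \<times> 'w mem \<Rightarrow> bool" where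
  "low_eq v2p vlev rlev = (\<lambda>(R, M) (R', M').
     (\<forall>r. rlev r = Lo \<longrightarrow> R r = R' r) \<and>
     (\<forall>x. vlev x = Lo \<longrightarrow> M (v2p x) = M' (v2p x)))"

fun low :: "'k action \<Rightarrow> 'k action" where
  "low (Out Ch_Low k) = Out Ch_Low k"
| "low _ = Tau"


section \<open>Transient faults and possibilistic fault-tolerant non-interference\<close>

datatype ('r, 'k) loc = Reg_Bit 'r nat | Mem_Bit 'k nat

definition faulty :: "('r, 'w::len word) loc set" where
  "faulty = {Reg_Bit r i | r i. i < LENGTH('w)} \<union> {Mem_Bit k i | k i. i < LENGTH('w)}"

definition flip_bits :: "nat set \<Rightarrow> 'w::len word \<Rightarrow> 'w word" where
  "flip_bits B w = horner_sum of_bool 2 (map (\<lambda>i. bit w i \<noteq> (i \<in> B)) [0..<LENGTH('w)])"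

lemma bit_flip_bits:
  fixes w :: "'w::len word"
  shows "i < LENGTH('w) \<Longrightarrow> bit (flip_bits B w) i \<longleftrightarrow> bit w i \<noteq> (i \<in> B)"
  by (simp add: flip_bits_def bit_horner_sum_bit_word_iff)

fun flip :: "('r, 'w::len) state \<Rightarrow> ('r, 'w word) loc set \<Rightarrow> ('r, 'w) state" where
  "flip (pc, R, M) L =
     (pc, \<lambda>r. flip_bits {i. Reg_Bit r i \<in> L} (R r), \<lambda>k. flip_bits {i. Mem_Bit k i \<in> L} (M k))"

inductive aug_step ::
  "('r, 'l, 'w::len word) program \<Rightarrow> ('r, 'w) state \<Rightarrow> ('r, 'w word) loc set \<Rightarrow> 'w word action \<Rightarrow>
   ('r, 'w) state \<Rightarrow> bool"
  for P where
  normal: "L \<subseteq> faulty \<Longrightarrow> \<not> stuck P s \<Longrightarrow> step P (flip s L) a s' \<Longrightarrow> aug_step P s L a s'"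
| fault_stuck: "L \<subseteq> faulty \<Longrightarrow> \<not> stuck P s \<Longrightarrow> stuck P (flip s L) \<Longrightarrow>
    aug_step P s L Tau (flip s L)"
| stuck: "L \<subseteq> faulty \<Longrightarrow> stuck P s \<Longrightarrow> aug_step P s L Tau s"

inductive aug_run ::
  "('r, 'l, 'w::len word) program \<Rightarrow> ('r, 'w) state \<Rightarrow> (('r, 'w word) loc set \<times> 'w word action) list \<Rightarrow>
   ('r, 'w) state \<Rightarrow> bool"
  for P where
  empty: "aug_run P s [] s"
| step: "aug_step P s L a s' \<Longrightarrow> aug_run P s' as s'' \<Longrightarrow> aug_run P s ((L, a) # as) s''"

definition has_trace ::
  "('r, 'l, 'w::len word) program \<Rightarrow> ('r, 'w) state \<Rightarrow> (('r, 'w word) loc set \<times> 'w word action) list \<Rightarrow>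
   bool" where
  "has_trace P s t \<longleftrightarrow> (\<exists>as s'. aug_run P s as s' \<and> t = map (\<lambda>(L, a). (L, low a)) as)"

definition PoNI ::
  "('v \<Rightarrow> 'w::len word) \<Rightarrow> ('v \<Rightarrow> level) \<Rightarrow> ('r \<Rightarrow> level) \<Rightarrow> ('r, 'l, 'w word) program \<Rightarrow> bool" where
  "PoNI v2p vlev rlev P \<longleftrightarrow>
    (\<forall>R M R' M'. low_eq v2p vlev rlev (R, M) (R', M') \<longrightarrow>
      (\<forall>t. has_trace P (0, R, M) t \<longleftrightarrow> has_trace P (0, R', M') t))"


section \<open>While-programs\<close>

datatype ('v, 'k) exp =
    Const 'k
  | Var 'v
  | Bin "'k \<Rightarrow> 'k \<Rightarrow> 'k" "('v, 'k) exp" "('v, 'k) exp"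

datatype ('v, 'k) com =
    Skip
  | Assign 'v "('v, 'k) exp"
  | If "('v, 'k) exp" "('v, 'k) com" "('v, 'k) com"
  | Print channel "('v, 'k) exp"
  | Seq "('v, 'k) com" "('v, 'k) com"
  | While 'v "('v, 'k) com"


section \<open>Register records\<close>

text \<open>
  Register records are partial maps. Injectivity is not built into the type: it is preserved by
  all the operations below, by passing to a smaller record, and holds for the empty record.
\<close>

type_synonym ('r, 'v) reg_record = "'r \<rightharpoonup> 'v"

definition rec_del :: "('r, 'v) reg_record \<Rightarrow> 'r \<Rightarrow> ('r, 'v) reg_record" where
  "rec_del \<Phi> r = \<Phi>(r := None)"

definition rec_assoc :: "('r, 'v) reg_record \<Rightarrow> 'r \<Rightarrow> 'v \<Rightarrow> ('r, 'v) reg_record" where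
  "rec_assoc \<Phi> r x = (\<lambda>r'. if \<Phi> r' = Some x then None else \<Phi> r')(r := Some x)"

definition rec_inter :: "('r, 'v) reg_record \<Rightarrow> ('r, 'v) reg_record \<Rightarrow> ('r, 'v) reg_record" where
  "rec_inter \<Phi> \<Phi>' = (\<lambda>r. if \<Phi> r = \<Phi>' r then \<Phi> r else None)"


section \<open>Code fragments\<close>

text \<open>
  Unlike a program, a fragment may contain the empty instruction, represented by \<^term>\<open>None\<close>
  in the second component. Every use of concatenation in the compilation rules that involves a
  fragment has, when bracketed to the right, a proper program as its right operand.

  The empty instruction passes its label on to the instruction that follows. In derivations, this
  and \<open>attach\<close> are only ever applied to code whose first instruction is unlabelled (see
  \<open>compile_first_label\<close> below), so that no label is overwritten.
\<close>

type_synonym ('r, 'l, 'k) fragment = "('l option \<times> ('r, 'l, 'k) instr option) list"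

fun attach :: "'l option \<Rightarrow> ('l option \<times> 'i) list \<Rightarrow> ('l option \<times> 'i) list" where
  "attach None P = P"
| "attach (Some l) [] = []"
| "attach (Some l) ((_, B) # P) = (Some l, B) # P"

fun fcat :: "('l option \<times> 'i option) list \<Rightarrow> ('l option \<times> 'i) list \<Rightarrow> ('l option \<times> 'i) list"
  (infixr "++>" 65) where
  "[] ++> P = P"
| "((l, Some B) # F) ++> P = (l, B) # (F ++> P)"
| "((l, None) # F) ++> P = attach l (F ++> P)"

definition fragment :: "('l option \<times> 'i) list \<Rightarrow> ('l option \<times> 'i option) list" where
  "fragment P = map (map_prod id Some) P"

text \<open>\<open>nops l m\<close> is \<^verbatim>\<open>l : nop^m\<close>.\<close>

definition nops :: "'l option \<Rightarrow> nat \<Rightarrow> ('r, 'l, 'k) fragment" where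
  "nops l m =
    (if m > 0 then attach l (replicate m (None, Some Nop)) else [(l, None)])"


section \<open>Annotations\<close>

datatype write_eff = Wr level

instantiation write_eff :: linorder
begin

fun less_eq_write_eff :: "write_eff \<Rightarrow> write_eff \<Rightarrow> bool" where
  "Wr a \<le> Wr b \<longleftrightarrow> b \<le> a"

fun less_write_eff :: "write_eff \<Rightarrow> write_eff \<Rightarrow> bool" where
  "Wr a < Wr b \<longleftrightarrow> b < a"

instance
proof
  fix a b c :: write_eff
  show "a < b \<longleftrightarrow> a \<le> b \<and> \<not> b \<le> a"
    by (cases a; cases b; auto)
  show "a \<le> a"
    by (cases a; simp)
  show "a \<le> b \<Longrightarrow> b \<le> c \<Longrightarrow> a \<le> c"
    by (cases a; cases b; cases c; simp)
  show "a \<le> b \<Longrightarrow> b \<le> a \<Longrightarrow> a = b"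
    by (cases a; cases b; simp)
  show "a \<le> b \<or> b \<le> a"
    by (cases a; cases b; auto)
qed

end

datatype timing = Trm nat | Trm_Level level

instantiation timing :: linorder
begin

fun less_eq_timing :: "timing \<Rightarrow> timing \<Rightarrow> bool" where
  "Trm m \<le> Trm n \<longleftrightarrow> m \<le> n"
| "Trm m \<le> Trm_Level b \<longleftrightarrow> True"
| "Trm_Level a \<le> Trm n \<longleftrightarrow> False"
| "Trm_Level a \<le> Trm_Level b \<longleftrightarrow> a \<le> b"

definition less_timing :: "timing \<Rightarrow> timing \<Rightarrow> bool" where
  "less_timing s t \<longleftrightarrow> s \<le> t \<and> \<not> t \<le> s"

instance
proof
  fix a b c :: timing
  show "a < b \<longleftrightarrow> a \<le> b \<and> \<not> b \<le> a"
    by (simp add: less_timing_def)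
  show "a \<le> a"
    by (cases a; simp)
  show "a \<le> b \<Longrightarrow> b \<le> c \<Longrightarrow> a \<le> c"
    by (cases a; cases b; cases c; simp)
  show "a \<le> b \<Longrightarrow> b \<le> a \<Longrightarrow> a = b"
    by (cases a; cases b; simp)
  show "a \<le> b \<or> b \<le> a"
    by (cases a; cases b; auto)
qed

end

definition tjoin :: "timing \<Rightarrow> timing \<Rightarrow> timing" (infixl "\<veebar>" 65) where
  "t1 \<veebar> t2 = (if t1 \<le> Trm_Level Lo \<and> t2 \<le> Trm_Level Lo then Trm_Level Lo else Trm_Level Hi)"

fun tplus :: "timing \<Rightarrow> timing \<Rightarrow> timing" (infixl "\<uplus>" 65) where
  "Trm m \<uplus> Trm n = Trm (m + n)"
| "t1 \<uplus> t2 = t1 \<veebar> t2"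

definition basic_annot :: "level \<Rightarrow> nat \<Rightarrow> write_eff \<times> timing" where
  "basic_annot \<kappa> n = (if \<kappa> = Hi then (Wr Hi, Trm (n + 1)) else (Wr Lo, Trm_Level Lo))"


section \<open>Compilation\<close>

inductive compile_exp ::
  "('v \<Rightarrow> 'w::len word) \<Rightarrow> ('v \<Rightarrow> level) \<Rightarrow> ('r \<Rightarrow> level) \<Rightarrow>
   ('r, 'v) reg_record \<Rightarrow> 'r set \<Rightarrow> 'l option \<Rightarrow> ('v, 'w word) exp \<Rightarrow>
   ('r, 'l, 'w word) fragment \<Rightarrow> level \<times> nat \<Rightarrow> 'r \<Rightarrow> ('r, 'v) reg_record \<Rightarrow> bool"
  for v2p vlev rlev where
  const: "r \<notin> A \<Longrightarrow>
    compile_exp v2p vlev rlev \<Phi> A l (Const k) [(l, Some (Movek r k))] (rlev r, 1) r (rec_del \<Phi> r)"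
| var_cached: "\<Phi> r = Some x \<Longrightarrow>
    compile_exp v2p vlev rlev \<Phi> A l (Var x) [(l, None)] (rlev r, 0) r \<Phi>"
| var_uncached: "r \<notin> A \<Longrightarrow> vlev x \<le> rlev r \<Longrightarrow>
    compile_exp v2p vlev rlev \<Phi> A l (Var x) [(l, Some (Load r (v2p x)))] (rlev r, 1) r
      (rec_assoc \<Phi> r x)"
| bin: "compile_exp v2p vlev rlev \<Phi> A l E1 P1 (\<kappa>, n1) r \<Phi>1 \<Longrightarrow>
    compile_exp v2p vlev rlev \<Phi>1 (A \<union> {r}) None E2 P2 (\<kappa>, n2) r' \<Phi>2 \<Longrightarrow>
    P = P1 ++> P2 ++> [(None, Op f r r')] \<Longrightarrow> distinct_labels P \<Longrightarrow>
    compile_exp v2p vlev rlev \<Phi> A l (Bin f E1 E2) (fragment P) (\<kappa>, n1 + n2 + 1) r (rec_del \<Phi>2 r)"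

text \<open>
  Labels that are fresh must differ from all other labels in the whole derivation, including those
  of sibling subderivations and those that are only jumped to. To express this, the judgement has
  two further arguments: the sets of labels in use before (\<open>U\<close>) and after (\<open>U'\<close>) the compilation
  of a command, threaded through the derivation.
\<close>

inductive compile_com ::
  "('v \<Rightarrow> 'w::len word) \<Rightarrow> ('v \<Rightarrow> level) \<Rightarrow> ('r \<Rightarrow> level) \<Rightarrow> 'l set \<Rightarrow>
   ('r, 'v) reg_record \<Rightarrow> 'l option \<Rightarrow> ('v, 'w word) com \<Rightarrow>
   ('r, 'l, 'w word) program \<Rightarrow> write_eff \<times> timing \<Rightarrow> 'l option \<Rightarrow> ('r, 'v) reg_record \<Rightarrow> 'l set \<Rightarrow> bool"
  for v2p vlev rlev where
  skip: "compile_com v2p vlev rlev U \<Phi> l Skip [(l, Nop)] (Wr Hi, Trm 1) None \<Phi> U"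
| assign: "compile_exp v2p vlev rlev \<Phi> {} l E P (vlev x, n) r \<Phi>' \<Longrightarrow>
    P' = P ++> [(None, Store (v2p x) r)] \<Longrightarrow> distinct_labels P' \<Longrightarrow>
    compile_com v2p vlev rlev U \<Phi> l (Assign x E) P' (basic_annot (vlev x) n) None
      (rec_assoc \<Phi>' r x) U"
| out: "compile_exp v2p vlev rlev \<Phi> {} l E P (ch_level ch, n) r \<Phi>' \<Longrightarrow>
    P' = P ++> [(None, Output ch r)] \<Longrightarrow> distinct_labels P' \<Longrightarrow>
    compile_com v2p vlev rlev U \<Phi> l (Print ch E) P' (basic_annot (ch_level ch) n) None \<Phi>' U"
| if_any: "compile_exp v2p vlev rlev \<Phi> {} l E P0 (\<kappa>, n0) r \<Phi>1 \<Longrightarrow>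
    br \<notin> U \<Longrightarrow> ex \<notin> U \<Longrightarrow> br \<noteq> ex \<Longrightarrow>
    compile_com v2p vlev rlev (U \<union> {br, ex}) \<Phi>1 None C1 P1 (w1, t1) l1 \<Phi>2 U1 \<Longrightarrow>
    compile_com v2p vlev rlev U1 \<Phi>1 None C2 P2 (w2, t2) l2 \<Phi>3 U2 \<Longrightarrow>
    w1 \<le> Wr \<kappa> \<Longrightarrow> w2 \<le> Wr \<kappa> \<Longrightarrow>
    P = P0 ++> [(None, Jz br r)] @ P1 @ [(l1, Jmp ex)] @ attach (Some br) P2 @ [(l2, Nop)] \<Longrightarrow>
    distinct_labels P \<Longrightarrow>
    compile_com v2p vlev rlev U \<Phi> l (If E C1 C2) P (Wr \<kappa>, Trm_Level \<kappa> \<veebar> t1 \<veebar> t2) (Some ex)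
      (rec_inter \<Phi>2 \<Phi>3) U2"
| if_high: "compile_exp v2p vlev rlev \<Phi> {} l E P0 (Hi, n0) r \<Phi>1 \<Longrightarrow>
    br \<notin> U \<Longrightarrow> ex \<notin> U \<Longrightarrow> br \<noteq> ex \<Longrightarrow>
    compile_com v2p vlev rlev (U \<union> {br, ex}) \<Phi>1 None C1 P1 (Wr Hi, Trm n1) l1 \<Phi>2 U1 \<Longrightarrow>
    compile_com v2p vlev rlev U1 \<Phi>1 None C2 P2 (Wr Hi, Trm n2) l2 \<Phi>3 U2 \<Longrightarrow>
    m = n0 + max n1 n2 + 2 \<Longrightarrow>
    P = P0 ++> [(None, Jz br r)] @ P1 @ (nops l1 (n2 - n1) ++> [(None, Jmp ex)] @
          attach (Some br) P2 @ (nops l2 (n1 - n2) ++> [(None, Nop)])) \<Longrightarrow>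
    distinct_labels P \<Longrightarrow>
    compile_com v2p vlev rlev U \<Phi> l (If E C1 C2) P (Wr Hi, Trm m) (Some ex) (rec_inter \<Phi>2 \<Phi>3) U2"
| seq: "compile_com v2p vlev rlev U \<Phi> l C1 P1 (w1, t1) l1 \<Phi>1 U1 \<Longrightarrow>
    compile_com v2p vlev rlev U1 \<Phi>1 l1 C2 P2 (w2, t2) l2 \<Phi>2 U2 \<Longrightarrow>
    (t1 = Trm_Level Hi \<longrightarrow> w2 = Wr Hi) \<Longrightarrow>
    distinct_labels (P1 @ P2) \<Longrightarrow>
    compile_com v2p vlev rlev U \<Phi> l (Seq C1 C2) (P1 @ P2) (max w1 w2, t1 \<uplus> t2) l2 \<Phi>2 U2"
| while: "\<kappa> = vlev x \<Longrightarrow> \<kappa> = rlev r \<Longrightarrow>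
    \<Phi>\<^sub>B \<subseteq>\<^sub>m rec_assoc \<Phi> r x \<Longrightarrow> \<Phi>\<^sub>B \<subseteq>\<^sub>m rec_assoc \<Phi>\<^sub>E r x \<Longrightarrow>
    lp \<notin> U \<Longrightarrow> ex \<notin> U \<Longrightarrow> lp \<noteq> ex \<Longrightarrow>
    compile_com v2p vlev rlev (U \<union> {lp, ex}) \<Phi>\<^sub>B None C P (w, t) l' \<Phi>\<^sub>E U' \<Longrightarrow>
    w \<le> Wr \<kappa> \<Longrightarrow> (t = Trm_Level Hi \<longrightarrow> Wr \<kappa> = Wr Hi) \<Longrightarrow>
    Pld = [(None, Load r (v2p x)), (None, Store (v2p x) r)] \<Longrightarrow>
    P' = attach l Pld @ [(Some lp, Jz ex r)] @ P @ attach l' Pld @ [(None, Jmp lp)] \<Longrightarrow>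
    distinct_labels P' \<Longrightarrow>
    compile_com v2p vlev rlev U \<Phi> l (While x C) P' (Wr \<kappa>, Trm_Level \<kappa> \<veebar> t) (Some ex) \<Phi>\<^sub>B U'"

definition compiles ::
  "('v \<Rightarrow> 'w::len word) \<Rightarrow> ('v \<Rightarrow> level) \<Rightarrow> ('r \<Rightarrow> level) \<Rightarrow>
   ('r, 'v) reg_record \<Rightarrow> 'l option \<Rightarrow> ('v, 'w word) com \<Rightarrow>
   ('r, 'l, 'w word) program \<Rightarrow> write_eff \<times> timing \<Rightarrow> 'l option \<Rightarrow> ('r, 'v) reg_record \<Rightarrow> bool" where
  "compiles v2p vlev rlev \<Phi> l C P wt l' \<Phi>' \<longleftrightarrow>
    (\<exists>U'. compile_com v2p vlev rlev (set_option l) \<Phi> l C P wt l' \<Phi>' U')"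

lemma attach_Nil_iff [simp]: "attach l P = [] \<longleftrightarrow> P = []"
  by (cases "(l, P)" rule: attach.cases) auto

lemma fst_hd_attach: "P \<noteq> [] \<Longrightarrow> fst (hd P) = None \<Longrightarrow> fst (hd (attach l P)) = l"
  by (cases "(l, P)" rule: attach.cases) auto

lemma compile_exp_first_label:
  "compile_exp v2p vlev rlev \<Phi> A l E F \<mu> r \<Phi>' \<Longrightarrow> Q \<noteq> [] \<Longrightarrow> fst (hd Q) = None \<Longrightarrow>
    F ++> Q \<noteq> [] \<and> fst (hd (F ++> Q)) = l"
proof (induction arbitrary: Q rule: compile_exp.induct)
  case (bin \<Phi> A l E1 P1 \<kappa> n1 r \<Phi>1 E2 P2 n2 r' \<Phi>2 P f)
  have "P2 ++> [(None, Op f r r')] \<noteq> [] \<and> fst (hd (P2 ++> [(None, Op f r r')])) = None"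
    using bin.IH(2)[of "[(None, Op f r r')]"] by simp
  then have "P \<noteq> [] \<and> fst (hd P) = l"
    using bin.IH(1)[of "P2 ++> [(None, Op f r r')]"] bin.hyps by simp
  then show ?case
    by (cases P) (auto simp: fragment_def)
qed (auto simp: fst_hd_attach)

lemma compile_first_label:
  "compile_com v2p vlev rlev U \<Phi> l C P wt l' \<Phi>' U' \<Longrightarrow> P \<noteq> [] \<and> fst (hd P) = l"
proof (induction rule: compile_com.induct)
  case assign
  then show ?case by (simp add: compile_exp_first_label)
next
  case out
  then show ?case by (simp add: compile_exp_first_label)
next
  case if_any
  then show ?case by (simp add: compile_exp_first_label)
next
  case if_high
  then show ?case by (simp add: compile_exp_first_label)
next
  case while
  then show ?case by (simp add: fst_hd_attach)
qed auto

end

theory Submission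
  imports Defs
begin

text \<open>
  For a fixed sequence of faults the machine is deterministic, so it suffices to relate two runs that
  suffer the same faults and to show that they stay related with equal low actions. Two states are
  related if they agree on low registers and low memory cells and are at the same position, or at two
  positions from which the same position is reached after the same number of high instructions, or if
  both are at positions from which only high instructions can be executed. The only instruction that
  separates two runs at the same position is a conditional jump on a high register; the timing
  annotations guarantee that its two branches are either balanced or followed by high code only. Register
  records play no role: faults may falsify them anyway, and what matters is only that every register
  keeps its level.
\<close>

section \<open>Labels and concatenation\<close>

lemma length_attach [simp]: "length (attach l P) = length P"
  by (cases "(l, P)" rule: attach.cases) auto

lemma snd_attach [simp]: "map snd (attach l P) = map snd P"
  by (cases "(l, P)" rule: attach.cases) auto

lemma snd_set_attach [simp]: "snd ` set (attach l P) = snd ` set P"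
  by (metis list.set_map snd_attach)

lemma labels_simps [simp]:
  "labels [] = []"
  "labels ((None, I) # P) = labels P"
  "labels ((Some l, I) # P) = l # labels P"
  "labels (P @ Q) = labels P @ labels Q"
  by (auto simp: labels_def List.map_filter_def)

lemma set_labels_Cons [simp]: "set (labels (p # P)) = set_option (fst p) \<union> set (labels P)"
  by (cases p; cases "fst p") auto

lemma set_labels_unlabelled [simp]: "set (labels (map (Pair None) Is)) = {}"
  by (induction Is) auto

lemma set_labels_attach: "set (labels (attach l P)) \<subseteq> set_option l \<union> set (labels P)"
  by (cases "(l, P)" rule: attach.cases) auto

lemma in_labels_conv_nth: "l \<in> set (labels P) \<longleftrightarrow> (\<exists>i<length P. fst (P ! i) = Some l)"
  by (induction P) (auto simp: less_Suc_eq_0_disj)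

lemma distinct_labels_nth:
  "distinct_labels P \<Longrightarrow> i < length P \<Longrightarrow> j < length P \<Longrightarrow>
    fst (P ! i) = Some l \<Longrightarrow> fst (P ! j) = Some l \<Longrightarrow> i = j"
proof (induction P arbitrary: i j)
  case (Cons p P)
  have "distinct_labels P"
    using Cons.prems(1) by (cases p; cases "fst p") (auto simp: distinct_labels_def)
  moreover have "l \<notin> set (labels P)" if "fst p = Some l"
    using Cons.prems(1) that by (cases p) (auto simp: distinct_labels_def)
  ultimately show ?case
    using Cons by (cases i; cases j) (auto simp: in_labels_conv_nth)
qed simp

lemma fcat_fragment [simp]: "fragment P ++> Q = P @ Q"
  by (induction P) (auto simp: fragment_def)

section \<open>Labelled blocks and the layout of compiled conditionals and loops\<close>

abbreviation block :: "'l option \<Rightarrow> 'i list \<Rightarrow> ('l option \<times> 'i) list" where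
  "block l Is \<equiv> attach l (map (Pair None) Is)"

lemma attach_single [simp]: "attach l [(None, I)] = [(l, I)]"
  by (cases l) auto

lemma attach_append: "P \<noteq> [] \<Longrightarrow> attach l P @ Q = attach l (P @ Q)"
  by (cases "(l, P)" rule: attach.cases) auto

lemma set_labels_block: "set (labels (block l Is)) \<subseteq> set_option l"
  using set_labels_attach[of l "map (Pair None) Is"] by simp

lemma snd_set_block [simp]: "snd ` set (block l Is) = set Is"
  by (simp add: image_image)

text \<open>For \<open>m = 0\<close> the empty instruction hands its label to \<open>I\<close>, for
  \<open>m > 0\<close> the first \<open>Nop\<close> carries it. The block form covers both, so
  padding needs no case distinction later.\<close>

lemma fcat_nops: "nops l m ++> (None, I) # Q = block l (replicate m Nop @ [I]) @ Q"
proof -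
  have "replicate k (None, Some Nop) ++> (None, I) # Q = replicate k (None, Nop) @ (None, I) # Q" for k
    by (induction k) auto
  then show ?thesis
    by (cases m; cases l) (auto simp: nops_def)
qed

text \<open>The code of the test and the \<open>Jz\<close> form a single block, since a cached
  variable contributes no instruction and its label then falls on the \<open>Jz\<close>. The final
  \<open>Nop\<close> of the second branch matches in time the \<open>Jmp ex\<close> of the
  first.\<close>

definition if_code ::
  "'l option \<Rightarrow> ('r, 'l, 'k) instr list \<Rightarrow> 'l \<Rightarrow> 'r \<Rightarrow> ('r, 'l, 'k) program \<Rightarrow> 'l option \<Rightarrow> nat \<Rightarrow>
   'l \<Rightarrow> ('r, 'l, 'k) program \<Rightarrow> 'l option \<Rightarrow> nat \<Rightarrow> ('r, 'l, 'k) program" where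
  "if_code l Is br r P1 l1 m1 ex P2 l2 m2 =
    block l (Is @ [Jz br r]) @ P1 @ block l1 (replicate m1 Nop @ [Jmp ex]) @
    attach (Some br) P2 @ block l2 (replicate m2 Nop @ [Nop])"

definition while_code ::
  "'l option \<Rightarrow> 'r \<Rightarrow> 'k \<Rightarrow> 'l \<Rightarrow> 'l \<Rightarrow> ('r, 'l, 'k) program \<Rightarrow> 'l option \<Rightarrow> ('r, 'l, 'k) program" where
  "while_code l r k lp ex P l' =
    block l [Load r k, Store k r] @ block (Some lp) [Jz ex r] @ P @
    block l' [Load r k, Store k r] @ [(None, Jmp lp)]"

lemma set_labels_if_code:
  "set (labels (if_code l Is br r P1 l1 m1 ex P2 l2 m2)) \<subseteq>
    set_option l \<union> set (labels P1) \<union> set_option l1 \<union> {br} \<union> set (labels P2) \<union> set_option l2"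
  using set_labels_block[of l "Is @ [Jz br r]"] set_labels_block[of l1 "replicate m1 Nop @ [Jmp ex]"]
    set_labels_attach[of "Some br" P2] set_labels_block[of l2 "replicate m2 Nop @ [Nop]"]
  unfolding if_code_def labels_simps set_append by (intro Un_least) blast+

lemma set_labels_while_code:
  "set (labels (while_code l r k lp ex P l')) \<subseteq>
    set_option l \<union> {lp} \<union> set (labels P) \<union> set_option l'"
  using set_labels_block[of l "[Load r k, Store k r]"] set_labels_block[of l' "[Load r k, Store k r]"]
    set_labels_block[of "Some lp" "[Jz ex r]"]
  unfolding while_code_def labels_simps set_append by (intro Un_least; force)

section \<open>Typed instructions and the shape of compiled code\<close>

locale security_levels =
  fixes v2p :: "'v \<Rightarrow> 'w::len word"
    and vlev :: "'v \<Rightarrow> level"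
    and rlev :: "'r \<Rightarrow> level"
  assumes inj_v2p: "inj v2p"
begin

section \<open>Levels of memory cells and typing of single instructions\<close>

definition low_cells :: "'w word set" where
  "low_cells = v2p ` {x. vlev x = Lo}"

text \<open>Injectivity matters here: otherwise a high variable could share its cell with a low
  one.\<close>

lemma v2p_in_low_cells [simp]: "v2p x \<in> low_cells \<longleftrightarrow> vlev x = Lo"
  using inj_v2p by (auto simp: low_cells_def inj_def)

text \<open>Excludes explicit flows from high sources to low targets. A \<open>Jz\<close> on a high
  register passes; such implicit flows are left to \<open>joins\<close>.\<close>

fun flow :: "('r, 'l, 'w word) instr \<Rightarrow> bool" where
  "flow (Load r k) \<longleftrightarrow> (rlev r = Lo \<longrightarrow> k \<in> low_cells)"
| "flow (Store k r) \<longleftrightarrow> (k \<in> low_cells \<longrightarrow> rlev r = Lo)"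
| "flow (Mover r r') \<longleftrightarrow> rlev r' \<le> rlev r"
| "flow (Op f r r') \<longleftrightarrow> rlev r' \<le> rlev r"
| "flow (Output ch r) \<longleftrightarrow> rlev r \<le> ch_level ch"
| "flow _ \<longleftrightarrow> True"

text \<open>Instructions whose effect cannot be noticed at the low level. Jumps count as high
  whatever register they test, since they change only the program counter.\<close>

fun high :: "('r, 'l, 'w word) instr \<Rightarrow> bool" where
  "high (Load r k) \<longleftrightarrow> rlev r = Hi"
| "high (Store k r) \<longleftrightarrow> k \<notin> low_cells"
| "high (Movek r k) \<longleftrightarrow> rlev r = Hi"
| "high (Mover r r') \<longleftrightarrow> rlev r = Hi"
| "high (Op f r r') \<longleftrightarrow> rlev r = Hi"
| "high (Output ch r) \<longleftrightarrow> ch = Ch_High"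
| "high _ \<longleftrightarrow> True"

definition typed :: "write_eff \<Rightarrow> ('r, 'l, 'w word) instr \<Rightarrow> bool" where
  "typed w I \<longleftrightarrow> flow I \<and> (w = Wr Hi \<longrightarrow> high I)"

fun straight :: "('r, 'l, 'w word) instr \<Rightarrow> bool" where
  "straight (Jmp _) \<longleftrightarrow> False"
| "straight (Jz _ _) \<longleftrightarrow> False"
| "straight _ \<longleftrightarrow> True"

lemma Wr_Hi_least [simp]: "w \<le> Wr Hi \<longleftrightarrow> w = Wr Hi" "Wr Hi \<le> w"
  by (cases w; auto simp: less_eq_level_def)+

lemma max_eq_Wr_Hi [simp]: "max w1 w2 = Wr Hi \<longleftrightarrow> w1 = Wr Hi \<and> w2 = Wr Hi"
  by (metis Wr_Hi_least(1) max.bounded_iff)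

text \<open>\<open>Wr Hi\<close> is the least effect and the one that demands most.\<close>

lemma typed_mono: "typed w I \<Longrightarrow> w \<le> w' \<Longrightarrow> typed w' I"
  by (auto simp: typed_def)

lemma level_le_simps [simp]: "\<kappa> \<le> Lo \<longleftrightarrow> \<kappa> = Lo" "\<kappa> \<le> Hi" "Lo \<le> \<kappa>" "Hi \<le> \<kappa> \<longleftrightarrow> \<kappa> = Hi"
  by (auto simp: less_eq_level_def)

lemma not_level_simps [simp]: "\<kappa> \<noteq> Lo \<longleftrightarrow> \<kappa> = Hi" "\<kappa> \<noteq> Hi \<longleftrightarrow> \<kappa> = Lo"
  by (cases \<kappa>; simp)+

text \<open>A fragment may consist of the empty instruction alone, so it is described by what it
  becomes in front of an arbitrary unlabelled instruction. Register records are dropped here; the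
  level of the result register and the instruction count survive.\<close>

lemma compile_exp_cases:
  assumes "compile_exp v2p vlev rlev \<Phi> A l E F (\<kappa>, n) r \<Phi>'"
  obtains Is where "rlev r = \<kappa>" "length Is = n" "\<And>I. I \<in> set Is \<Longrightarrow> straight I \<and> typed (Wr \<kappa>) I"
    "\<And>I Q. F ++> (None, I) # Q = block l (Is @ [I]) @ Q"
proof -
  have "rlev r = fst \<mu> \<and> (\<exists>Is. length Is = snd \<mu> \<and>
      (\<forall>I\<in>set Is. straight I \<and> typed (Wr (fst \<mu>)) I) \<and>
      (\<forall>I Q. F ++> (None, I) # Q = block l (Is @ [I]) @ Q))"
    if "compile_exp v2p vlev rlev \<Phi> A l E F \<mu> r \<Phi>'" for \<Phi> A l E F \<mu> r \<Phi>'
    using that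
  proof (induction rule: compile_exp.induct)
    case (const r A \<Phi> l k)
    show ?case
      by (rule conjI, simp, rule exI[of _ "[Movek r k]"]) (cases l; auto simp: typed_def)
  next
    case (var_uncached r A x \<Phi> l)
    then show ?case
      by (intro conjI, simp, intro exI[of _ "[Load r (v2p x)]"]) (cases l; auto simp: typed_def)
  next
    case (var_cached \<Phi> r x A l)
    then show ?case
      by (cases l) auto
  next
    case (bin \<Phi> A l E1 P1 \<kappa> n1 r \<Phi>1 E2 P2 n2 r' \<Phi>2 P f)
    from bin.IH obtain Is1 Is2 where Is:
      "length Is1 = n1" "\<forall>I\<in>set Is1. straight I \<and> typed (Wr \<kappa>) I"
      "\<And>I Q. P1 ++> (None, I) # Q = block l (Is1 @ [I]) @ Q"
      "length Is2 = n2" "\<forall>I\<in>set Is2. straight I \<and> typed (Wr \<kappa>) I"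
      "\<And>I Q. P2 ++> (None, I) # Q = block None (Is2 @ [I]) @ Q"
      by auto
    have levels: "rlev r = \<kappa>" "rlev r' = \<kappa>"
      using bin.IH by auto
    let ?Is = "Is1 @ Is2 @ [Op f r r']"
    \<comment> \<open>\<open>P1\<close> may be the empty instruction alone; its label then moves to
      the first instruction \<open>I\<close> of what follows, which exists because of the final
      \<open>Op\<close>.\<close>
    obtain I Js where "Is2 @ [Op f r r'] = I # Js"
      by (cases "Is2 @ [Op f r r']") auto
    then have "P = block l ?Is"
      using Is(3)[of I "map (Pair None) Js"] Is(6)[of "Op f r r'" "[]"] bin.hyps
      by (simp add: attach_append)
    then have "fragment P ++> (None, I) # Q = block l (?Is @ [I]) @ Q" for I Q
      by (simp add: attach_append)
    then show ?case
      using levels Is by (intro conjI, simp, intro exI[of _ ?Is]) (auto simp: typed_def)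
  qed
  from this[OF assms] that show thesis by fastforce
qed

text \<open>
  A common abstraction of the compilation rules: both rules for conditionals become \<open>branch\<close>, where
  \<open>m1\<close> and \<open>m2\<close> count the padding instructions (none in the rule without timing constraints).
\<close>

inductive assembled ::
  "'l option \<Rightarrow> ('r, 'l, 'w word) program \<Rightarrow> write_eff \<Rightarrow> timing \<Rightarrow> 'l option \<Rightarrow> bool" where
  block: "Is \<noteq> [] \<Longrightarrow> (\<And>I. I \<in> set Is \<Longrightarrow> straight I \<and> typed w I) \<Longrightarrow> t \<noteq> Trm_Level Hi \<Longrightarrow>
    (\<And>n. t = Trm n \<Longrightarrow> w = Wr Hi \<and> n = length Is) \<Longrightarrow> assembled l (block l Is) w t None"
| seq: "assembled l P1 w1 t1 l1 \<Longrightarrow> assembled l1 P2 w2 t2 l2 \<Longrightarrow>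
    (t1 = Trm_Level Hi \<Longrightarrow> w2 = Wr Hi) \<Longrightarrow> assembled l (P1 @ P2) (max w1 w2) (t1 \<uplus> t2) l2"
| branch: "(\<And>I. I \<in> set Is \<Longrightarrow> straight I \<and> typed w I) \<Longrightarrow>
    assembled None P1 w1 t1 l1 \<Longrightarrow> assembled None P2 w2 t2 l2 \<Longrightarrow> w1 \<le> w \<Longrightarrow> w2 \<le> w \<Longrightarrow>
    (rlev r = Hi \<Longrightarrow> w = Wr Hi) \<Longrightarrow>
    (\<exists>n1 n2. t1 = Trm n1 \<and> t2 = Trm n2 \<and> n1 + m1 = n2 + m2 \<and> w = Wr Hi \<and>
        t = Trm (length Is + n1 + m1 + 2)) \<or>
      (\<exists>\<kappa>. t = Trm_Level \<kappa> \<and> rlev r \<le> \<kappa> \<and> t1 \<le> t \<and> t2 \<le> t) \<Longrightarrow>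
    assembled l (if_code l Is br r P1 l1 m1 ex P2 l2 m2) w t (Some ex)"
| loop: "rlev r = vlev x \<Longrightarrow> assembled None P w t l' \<Longrightarrow> w \<le> Wr (rlev r) \<Longrightarrow> t \<le> Trm_Level (rlev r) \<Longrightarrow>
    assembled l (while_code l r (v2p x) lp ex P l') (Wr (rlev r)) (Trm_Level (rlev r)) (Some ex)"

lemma Trm_Level_Hi_greatest [simp]: "t \<le> Trm_Level Hi" "Trm_Level Hi \<le> t \<longleftrightarrow> t = Trm_Level Hi"
  by (cases t; auto)+

lemma timing_le_Lo [simp]: "t \<le> Trm_Level Lo \<longleftrightarrow> t \<noteq> Trm_Level Hi"
  using not_level_simps by (cases t) auto

lemma tplus_eq_Hi: "t1 \<uplus> t2 = Trm_Level Hi \<longleftrightarrow> t1 = Trm_Level Hi \<or> t2 = Trm_Level Hi"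
  by (cases t1; cases t2) (auto simp: tjoin_def)

lemma compile_com_assembled:
  "compile_com v2p vlev rlev U \<Phi> l C P wt l' \<Phi>' U' \<Longrightarrow> assembled l P (fst wt) (snd wt) l'"
proof (induction rule: compile_com.induct)
  case (skip U \<Phi> l)
  have "assembled l (block l [Nop]) (Wr Hi) (Trm 1) None"
    by (rule assembled.block) (auto simp: typed_def)
  then show ?case
    by simp
next
  case (assign \<Phi> l E F x n r \<Phi>' P U)
  from assign.hyps(1) obtain Is where Is: "rlev r = vlev x" "length Is = n"
    "\<And>I. I \<in> set Is \<Longrightarrow> straight I \<and> typed (Wr (vlev x)) I"
    "F ++> [(None, Store (v2p x) r)] = block l (Is @ [Store (v2p x) r])"
    by (rule compile_exp_cases) (rule that, auto)
  then show ?case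
    unfolding assign.hyps(2) Is(4)
    by (intro assembled.block; cases "vlev x") (auto simp: basic_annot_def typed_def)
next
  case (out \<Phi> l E F ch n r \<Phi>' P U)
  from out.hyps(1) obtain Is where Is: "rlev r = ch_level ch" "length Is = n"
    "\<And>I. I \<in> set Is \<Longrightarrow> straight I \<and> typed (Wr (ch_level ch)) I"
    "F ++> [(None, Output ch r)] = block l (Is @ [Output ch r])"
    by (rule compile_exp_cases) (rule that, auto)
  then show ?case
    unfolding out.hyps(2) Is(4)
    by (intro assembled.block; cases ch) (auto simp: basic_annot_def typed_def)
next
  case (if_any \<Phi> l E P0 \<kappa> n0 r \<Phi>1 br U ex C1 P1 w1 t1 l1 \<Phi>2 U1 C2 P2 w2 t2 l2 \<Phi>3 U2 P)
  from if_any.hyps(1) obtain Is where Is: "rlev r = \<kappa>"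
    "\<And>I. I \<in> set Is \<Longrightarrow> straight I \<and> typed (Wr \<kappa>) I" "P = if_code l Is br r P1 l1 0 ex P2 l2 0"
    by (rule compile_exp_cases) (rule that, use if_any.hyps in \<open>auto simp: if_code_def\<close>)
  then show ?case
    unfolding Is(3) using if_any.IH if_any.hyps
    by (intro assembled.branch[where ?w1.0 = w1 and ?w2.0 = w2 and ?t1.0 = t1 and ?t2.0 = t2])
      (auto simp: tjoin_def)
next
  case (if_high \<Phi> l E P0 n0 r \<Phi>1 br U ex C1 P1 n1 l1 \<Phi>2 U1 C2 P2 n2 l2 \<Phi>3 U2 m P)
  from if_high.hyps(1) obtain Is where Is: "length Is = n0"
    "\<And>I. I \<in> set Is \<Longrightarrow> straight I \<and> typed (Wr Hi) I"
    "P = if_code l Is br r P1 l1 (n2 - n1) ex P2 l2 (n1 - n2)"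
    by (rule compile_exp_cases) (rule that, use if_high.hyps in \<open>auto simp: if_code_def fcat_nops\<close>)
  \<comment> \<open>By truncated subtraction \<open>n1 + (n2 - n1)\<close> and
    \<open>n2 + (n1 - n2)\<close> both equal \<open>max n1 n2\<close>, which is the balance that
    \<open>assembled.branch\<close> demands.\<close>
  then show ?case
    unfolding Is(3) using if_high.IH if_high.hyps
    by (intro assembled.branch) auto
next
  case (seq U \<Phi> l C1 P1 w1 t1 l1 \<Phi>1 U1 C2 P2 w2 t2 l2 \<Phi>2 U2)
  show ?case
    unfolding fst_conv snd_conv by (rule assembled.seq) (use seq in auto)
next
  case (while \<kappa> x r \<Phi>\<^sub>B \<Phi> \<Phi>\<^sub>E lp U ex C P w t l' U' Pld P' l)
  have "P' = while_code l r (v2p x) lp ex P l'"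
    using while.hyps(11,12) by (simp add: while_code_def)
  \<comment> \<open>The side condition of the rule excludes \<open>Trm_Level Hi\<close> for the body
    of a loop with a low test; hence the join is just the level of the test.\<close>
  moreover have "t \<le> Trm_Level \<kappa>" "Trm_Level \<kappa> \<veebar> t = Trm_Level \<kappa>"
    using while.hyps(10) by (cases \<kappa>; auto simp: tjoin_def)+
  moreover have "assembled l (while_code l r (v2p x) lp ex P l') (Wr (rlev r)) (Trm_Level (rlev r)) (Some ex)"
    if "t \<le> Trm_Level (rlev r)"
    using while.IH while.hyps(1,2,9) that by (intro assembled.loop[where w = w and t = t]) simp_all
  ultimately show ?case
    using while.hyps(2) by simp
qed

lemma assembled_typed: "assembled l P w t l' \<Longrightarrow> I \<in> snd ` set P \<Longrightarrow> typed w I"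
proof (induction rule: assembled.induct)
  case (branch Is w P1 w1 t1 l1 P2 w2 t2 l2 r m1 m2 t l br ex)
  have "typed w I" if "I \<in> snd ` set P1 \<or> I \<in> snd ` set P2"
    using branch.IH branch.hyps(4,5) that typed_mono by blast
  then show ?case
    using branch.prems branch.hyps(1)
    by (auto simp: if_code_def image_Un typed_def simp del: map_append map_replicate)
next
  case (loop r x P w t l' l lp ex)
  have "typed (Wr (rlev r)) I" if "I \<in> snd ` set P"
    using loop.IH loop.hyps(3) that typed_mono by blast
  then show ?case
    using loop.prems loop.hyps(1) by (auto simp: while_code_def image_Un typed_def)
next
  case (seq l P1 w1 t1 l1 P2 w2 t2 l2)
  then show ?case
    using typed_mono[of w1 I "max w1 w2"] typed_mono[of w2 I "max w1 w2"] by (auto simp: image_Un)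
qed auto

text \<open>Serves two purposes: code with empty entry label can receive a label by
  \<open>attach\<close>, and placed code resolves its own entry label, which in a sequence is the
  exit label of the preceding command.\<close>

lemma assembled_first_label: "assembled l P w t l' \<Longrightarrow> P \<noteq> [] \<and> fst (hd P) = l"
proof (induction rule: assembled.induct)
  case (block Is w t l)
  then show ?case by (cases Is; cases l) auto
next
  case (branch Is w P1 w1 t1 l1 P2 w2 t2 l2 r m1 m2 t l br ex)
  then show ?case by (cases Is; cases l) (auto simp: if_code_def)
next
  case (loop r x P w t l' l lp ex)
  then show ?case by (cases l) (auto simp: while_code_def)
qed auto

text \<open>The aim is the last conjunct: the exit label of the whole program labels no instruction,
  so a jump to it gets stuck. The other conjuncts strengthen the induction: sibling subderivations
  draw their labels from disjoint differences of the threaded sets.\<close>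

lemma compile_com_labels:
  "compile_com v2p vlev rlev U \<Phi> l C P wt l' \<Phi>' U' \<Longrightarrow> set_option l \<subseteq> U \<Longrightarrow>
    U \<subseteq> U' \<and> set (labels P) \<subseteq> set_option l \<union> (U' - U) \<and>
    set_option l' \<subseteq> U' - U - set (labels P)"
proof (induction rule: compile_com.induct)
  case (assign \<Phi> l E F x n r)
  from assign.hyps(1) obtain Is where "F ++> [(None, Store (v2p x) r)] = block l (Is @ [Store (v2p x) r])"
    by (rule compile_exp_cases) (rule that, auto)
  then show ?case
    unfolding assign.hyps(2) using set_labels_block[of l "Is @ [Store (v2p x) r]"] by simp
next
  case (out \<Phi> l E F ch n r)
  from out.hyps(1) obtain Is where "F ++> [(None, Output ch r)] = block l (Is @ [Output ch r])"
    by (rule compile_exp_cases) (rule that, auto)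
  then show ?case
    unfolding out.hyps(2) using set_labels_block[of l "Is @ [Output ch r]"] by simp
next
  case (if_any \<Phi> l E P0 \<kappa> n0 r \<Phi>1 br U ex C1 P1 w1 t1 l1 \<Phi>2 U1 C2 P2 w2 t2 l2 \<Phi>3 U2 P)
  from if_any.hyps(1) obtain Is where "P = if_code l Is br r P1 l1 0 ex P2 l2 0"
    by (rule compile_exp_cases) (rule that, use if_any.hyps in \<open>auto simp: if_code_def\<close>)
  then have "set (labels P) \<subseteq> set_option l \<union> set (labels P1) \<union> set_option l1 \<union> {br} \<union>
      set (labels P2) \<union> set_option l2"
    using set_labels_if_code by metis
  moreover have "U \<union> {br, ex} \<subseteq> U1" "set (labels P1) \<union> set_option l1 \<subseteq> U1 - (U \<union> {br, ex})"
    "U1 \<subseteq> U2" "set (labels P2) \<union> set_option l2 \<subseteq> U2 - U1"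
    using if_any.IH by auto
  ultimately show ?case
    using if_any.prems if_any.hyps(2-4) unfolding option.set by (intro conjI) blast+
next
  case (if_high \<Phi> l E P0 n0 r \<Phi>1 br U ex C1 P1 n1 l1 \<Phi>2 U1 C2 P2 n2 l2 \<Phi>3 U2 m P)
  from if_high.hyps(1) obtain Is where "P = if_code l Is br r P1 l1 (n2 - n1) ex P2 l2 (n1 - n2)"
    by (rule compile_exp_cases) (rule that, use if_high.hyps in \<open>auto simp: if_code_def fcat_nops\<close>)
  then have "set (labels P) \<subseteq> set_option l \<union> set (labels P1) \<union> set_option l1 \<union> {br} \<union>
      set (labels P2) \<union> set_option l2"
    using set_labels_if_code by metis
  moreover have "U \<union> {br, ex} \<subseteq> U1" "set (labels P1) \<union> set_option l1 \<subseteq> U1 - (U \<union> {br, ex})"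
    "U1 \<subseteq> U2" "set (labels P2) \<union> set_option l2 \<subseteq> U2 - U1"
    using if_high.IH by auto
  ultimately show ?case
    using if_high.prems if_high.hyps(2-4) unfolding option.set by (intro conjI) blast+
next
  case (seq U \<Phi> l C1 P1 w1 t1 l1 \<Phi>1 U1 C2 P2 w2 t2 l2 \<Phi>2 U2)
  have 1: "U \<subseteq> U1" "set (labels P1) \<subseteq> set_option l \<union> (U1 - U)" "set_option l1 \<subseteq> U1 - U"
    using seq.IH(1) seq.prems by auto
  moreover have "U1 \<subseteq> U2" "set (labels P2) \<subseteq> set_option l1 \<union> (U2 - U1)"
    "set_option l2 \<subseteq> U2 - U1 - set (labels P2)"
    using seq.IH(2) 1(3) by auto
  ultimately show ?case
    using seq.prems unfolding labels_simps set_append by (intro conjI) blast+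
next
  case (while \<kappa> x r \<Phi>\<^sub>B \<Phi> \<Phi>\<^sub>E lp U ex C P w t l' U' Pld P' l)
  have "P' = while_code l r (v2p x) lp ex P l'"
    using while.hyps(11,12) by (simp add: while_code_def)
  then have "set (labels P') \<subseteq> set_option l \<union> {lp} \<union> set (labels P) \<union> set_option l'"
    using set_labels_while_code by metis
  moreover have "U \<union> {lp, ex} \<subseteq> U'" "set (labels P) \<union> set_option l' \<subseteq> U' - (U \<union> {lp, ex})"
    using while.IH by auto
  ultimately show ?case
    using while.prems while.hyps(5-7) unfolding option.set by (intro conjI) blast+
qed auto

end

section \<open>Timed and silent positions\<close>

text \<open>Code is an arbitrary map on natural numbers, not a list: a fragment can then be studied
  at any offset inside a larger program, and offsets do not overflow.\<close>

locale code_memory = security_levels v2p vlev rlev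
  for v2p :: "'v \<Rightarrow> 'w::len word" and vlev :: "'v \<Rightarrow> level" and rlev :: "'r \<Rightarrow> level" +
  fixes code :: "nat \<Rightarrow> ('r, 'l, 'w word) instr option"
    and resolve :: "'l \<Rightarrow> nat option"
begin

text \<open>Ignores data: a fault can change the register tested by a \<open>Jz\<close>, so both
  outcomes are counted. An unresolved label contributes no successor.\<close>

definition succs :: "nat \<Rightarrow> nat set" where
  "succs i = (case code i of
      None \<Rightarrow> {}
    | Some (Jmp l) \<Rightarrow> set_option (resolve l)
    | Some (Jz l r) \<Rightarrow> insert (Suc i) (set_option (resolve l))
    | Some _ \<Rightarrow> {Suc i})"

fun resolved :: "('r, 'l, 'w word) instr \<Rightarrow> bool" where
  "resolved (Jmp l) \<longleftrightarrow> resolve l \<noteq> None"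
| "resolved (Jz l r) \<longleftrightarrow> resolve l \<noteq> None"
| "resolved _ \<longleftrightarrow> True"

lemma succs_straight: "code i = Some I \<Longrightarrow> straight I \<Longrightarrow> succs i = {Suc i}"
  by (cases I) (auto simp: succs_def)

lemma resolved_straight: "straight I \<Longrightarrow> resolved I"
  by (cases I) auto

text \<open>
  From position \<open>i\<close>, every execution reaches \<open>e\<close> in exactly \<open>n\<close> high steps, whatever the faults: all
  labels involved must be resolved, since a stuck state is not affected by faults.
\<close>

fun timed :: "nat \<Rightarrow> nat \<Rightarrow> nat \<Rightarrow> bool" where
  "timed 0 e i \<longleftrightarrow> i = e"
| "timed (Suc n) e i \<longleftrightarrow> (\<exists>I. code i = Some I \<and> high I \<and> resolved I \<and> (\<forall>j\<in>succs i. timed n e j))"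

declare timed.simps(2) [simp del]

text \<open>Coinductive, because high code may loop forever. A position without code is silent
  vacuously.\<close>

coinductive silent :: "nat \<Rightarrow> bool" where
  "(\<And>I. code i = Some I \<Longrightarrow> high I) \<Longrightarrow> (\<And>j. j \<in> succs i \<Longrightarrow> silent j) \<Longrightarrow> silent i"

text \<open>The number of steps is a successor because \<open>timed 0 i i\<close> holds for every
  \<open>i\<close> and would make the condition void.\<close>

definition joins :: "nat \<Rightarrow> bool" where
  "joins i \<longleftrightarrow> (\<forall>l r. code i = Some (Jz l r) \<longrightarrow> rlev r = Hi \<longrightarrow> silent i \<or> (\<exists>n e. timed (Suc n) e i))"

lemma joins_straight: "code i = Some I \<Longrightarrow> straight I \<Longrightarrow> joins i"
  by (cases I) (auto simp: joins_def)

section \<open>Placement of code fragments in memory\<close>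

definition placed :: "('r, 'l, 'w word) program \<Rightarrow> nat \<Rightarrow> bool" where
  "placed P b \<longleftrightarrow> (\<forall>i<length P. code (b + i) = Some (snd (P ! i)) \<and>
    (\<forall>l. fst (P ! i) = Some l \<longrightarrow> resolve l = Some (b + i)))"

lemma placed_Nil [simp]: "placed [] b"
  by (simp add: placed_def)

lemma placed_Cons [simp]:
  "placed ((l, I) # P) b \<longleftrightarrow>
    code b = Some I \<and> (\<forall>l'. l = Some l' \<longrightarrow> resolve l' = Some b) \<and> placed P (Suc b)"
  by (auto simp: placed_def All_less_Suc2)

lemma placed_append [simp]: "placed (P @ Q) b \<longleftrightarrow> placed P b \<and> placed Q (b + length P)"
  by (induction P arbitrary: b) auto

lemma placed_attach:
  "P \<noteq> [] \<Longrightarrow> fst (hd P) = None \<Longrightarrow>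
    placed (attach l P) b \<longleftrightarrow> placed P b \<and> (\<forall>l'. l = Some l' \<longrightarrow> resolve l' = Some b)"
  by (cases "(l, P)" rule: attach.cases) auto

lemma placed_block:
  "Is \<noteq> [] \<Longrightarrow> placed (block l Is) b \<longleftrightarrow>
    placed (map (Pair None) Is) b \<and> (\<forall>l'. l = Some l' \<longrightarrow> resolve l' = Some b)"
  by (rule placed_attach) (cases Is; simp)+

lemma placed_unlabelled: "placed (map (Pair None) Is) b \<longleftrightarrow> (\<forall>i<length Is. code (b + i) = Some (Is ! i))"
  by (auto simp: placed_def)

lemma placed_first_label: "placed P b \<Longrightarrow> P \<noteq> [] \<Longrightarrow> fst (hd P) = Some l \<Longrightarrow> resolve l = Some b"
  by (cases P) auto

lemma placed_code:
  assumes "placed P b" "i \<in> {b..<b + length P}"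
  shows "\<exists>I\<in>snd ` set P. code i = Some I"
proof -
  have "code i = Some (snd (P ! (i - b)))" "i - b < length P"
    using assms by (auto simp: placed_def dest: spec[of _ "i - b"])
  then show ?thesis
    by auto
qed

section \<open>Timing and silence of straight-line code, and addresses of the parts of a
  layout\<close>

lemma timed_trans: "timed m j i \<Longrightarrow> timed n e j \<Longrightarrow> timed (m + n) e i"
  by (induction m arbitrary: i) (auto simp: timed.simps(2))

lemma timed_straight:
  assumes "placed (map (Pair None) Is) b" "\<And>I. I \<in> set Is \<Longrightarrow> straight I \<and> high I"
  shows "timed (length Is) (b + length Is) b"
  using assms
proof (induction Is arbitrary: b)
  case (Cons I Is)
  then have "succs b = {Suc b}" "resolved I"
    by (auto simp: succs_straight resolved_straight)
  then show ?case
    using Cons.prems Cons.IH[of "Suc b"] by (simp add: timed.simps(2))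
qed simp

lemma timed_nops:
  assumes "placed (map (Pair None) (replicate m Nop)) b" "timed n e (b + m)"
  shows "timed (m + n) e b"
  using timed_trans[of m "b + m" b n e] timed_straight[OF assms(1)] assms(2) by simp

lemma silent_straight:
  assumes "placed (map (Pair None) Is) b" "\<And>I. I \<in> set Is \<Longrightarrow> straight I \<and> high I" "silent (b + length Is)"
  shows "silent b"
  using assms
proof (induction Is arbitrary: b)
  case (Cons I Is)
  have "succs b = {Suc b}"
    using Cons.prems(1,2) by (simp add: succs_straight)
  moreover have "silent (Suc b)"
    using Cons.prems Cons.IH[of "Suc b"] by simp
  ultimately show ?case
    by (intro silent.intros[of b]) (use Cons.prems(1,2) in auto)
qed simp

text \<open>\<open>b1\<close>, \<open>b2\<close> are the entries of the branches and
  \<open>e1\<close>, \<open>e2\<close> their ends before padding; \<open>e1 + m1\<close> holds the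
  jump to the exit and \<open>e2 + m2\<close> the closing \<open>Nop\<close>.\<close>

lemma placed_if_code:
  assumes "placed (if_code l Is br r P1 l1 m1 ex P2 l2 m2) b"
    "P1 \<noteq> []" "P2 \<noteq> []" "fst (hd P2) = None"
  obtains b1 e1 b2 e2 where
    "b1 = b + length Is + 1" "e1 = b1 + length P1" "b2 = e1 + m1 + 1" "e2 = b2 + length P2"
    "b + length (if_code l Is br r P1 l1 m1 ex P2 l2 m2) = Suc (e2 + m2)"
    "placed (map (Pair None) Is) b" "code (b + length Is) = Some (Jz br r)"
    "placed P1 b1" "placed (map (Pair None) (replicate m1 Nop)) e1" "code (e1 + m1) = Some (Jmp ex)"
    "placed P2 b2" "placed (map (Pair None) (replicate m2 Nop)) e2" "code (e2 + m2) = Some Nop"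
    "resolve br = Some b2" "\<And>l'. l1 = Some l' \<Longrightarrow> resolve l' = Some e1"
    "\<And>l'. l2 = Some l' \<Longrightarrow> resolve l' = Some e2"
proof -
  define b1 where "b1 = b + length Is + 1"
  define e1 where "e1 = b1 + length P1"
  define b2 where "b2 = e1 + m1 + 1"
  define e2 where "e2 = b2 + length P2"
  have "placed (block l (Is @ [Jz br r])) b \<and> placed P1 b1 \<and>
      placed (block l1 (replicate m1 Nop @ [Jmp ex])) e1 \<and> placed (attach (Some br) P2) b2 \<and>
      placed (block l2 (replicate m2 Nop @ [Nop])) e2"
    using assms(1) by (simp add: if_code_def b1_def e1_def b2_def e2_def add.assoc del: map_append)
  then have "placed (map (Pair None) (Is @ [Jz br r])) b \<and> placed P1 b1 \<and>
      placed (map (Pair None) (replicate m1 Nop @ [Jmp ex])) e1 \<and>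
      (\<forall>l'. l1 = Some l' \<longrightarrow> resolve l' = Some e1) \<and> placed P2 b2 \<and> resolve br = Some b2 \<and>
      placed (map (Pair None) (replicate m2 Nop @ [Nop])) e2 \<and>
      (\<forall>l'. l2 = Some l' \<longrightarrow> resolve l' = Some e2)"
    using assms(2-) by (simp add: placed_block placed_attach del: map_append map_replicate list.map)
  moreover have "b + length (if_code l Is br r P1 l1 m1 ex P2 l2 m2) = Suc (e2 + m2)"
    by (simp add: if_code_def b1_def e1_def b2_def e2_def)
  ultimately show thesis
    using that[OF b1_def e1_def b2_def e2_def] by simp
qed

text \<open>The jump at \<open>e1 + 2\<close> returns to the test at \<open>b + 2\<close>, behind
  the initial load and store; these are repeated from \<open>e1\<close>, the end of the
  body.\<close>

lemma placed_while_code: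
  assumes "placed (while_code l r k lp ex P l') b"
  obtains b1 e1 where "b1 = b + 3" "e1 = b1 + length P"
    "b + length (while_code l r k lp ex P l') = e1 + 3"
    "code b = Some (Load r k)" "code (b + 1) = Some (Store k r)" "code (b + 2) = Some (Jz ex r)"
    "placed P b1" "code e1 = Some (Load r k)" "code (e1 + 1) = Some (Store k r)"
    "code (e1 + 2) = Some (Jmp lp)" "resolve lp = Some (b + 2)"
    "\<And>x. l' = Some x \<Longrightarrow> resolve x = Some e1"
proof -
  define b1 where "b1 = b + 3"
  define e1 where "e1 = b1 + length P"
  have "placed (block l [Load r k, Store k r]) b \<and> code (b + 2) = Some (Jz ex r) \<and>
      resolve lp = Some (b + 2) \<and> placed P b1 \<and> placed (block l' [Load r k, Store k r]) e1 \<and>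
      code (e1 + 2) = Some (Jmp lp)"
    using assms by (simp add: while_code_def b1_def e1_def numeral_eq_Suc)
  then have "placed (map (Pair None) [Load r k, Store k r]) b \<and> code (b + 2) = Some (Jz ex r) \<and>
      resolve lp = Some (b + 2) \<and> placed P b1 \<and> placed (map (Pair None) [Load r k, Store k r]) e1 \<and>
      (\<forall>x. l' = Some x \<longrightarrow> resolve x = Some e1) \<and> code (e1 + 2) = Some (Jmp lp)"
    by (simp add: placed_block del: list.map)
  moreover have "b + length (while_code l r k lp ex P l') = e1 + 3"
    by (simp add: while_code_def b1_def e1_def)
  ultimately show thesis
    using that[OF b1_def e1_def] by simp
qed

section \<open>Control flow, silence and timing of assembled code\<close>

lemma interval_cases:
  fixes i :: nat
  assumes "i \<in> {a..<c}" "i \<in> {a..<b} \<Longrightarrow> thesis" "i \<in> {b..<c} \<Longrightarrow> thesis"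
  shows thesis
  using assms by (meson atLeastLessThan_iff linorder_not_less)

text \<open>Inner labels are resolved by the placement, so control can leave only through the end or
  through the exit label. The latter is constrained only where it is resolved, since the exit label
  of the whole program is not.\<close>

lemma assembled_succs:
  assumes "assembled l P w t l'" "placed P b" "\<And>ex e. l' = Some ex \<Longrightarrow> resolve ex = Some e \<Longrightarrow> e = b + length P"
    "i \<in> {b..<b + length P}"
  shows "succs i \<subseteq> {b..b + length P}"
  using assms
proof (induction arbitrary: b i rule: assembled.induct)
  case (block Is w t l)
  then have "code i = Some (Is ! (i - b))" "straight (Is ! (i - b))"
    using placed_unlabelled[of Is b] by (auto simp: placed_block dest: spec[of _ "i - b"])
  then show ?case
    using block.prems by (simp add: succs_straight)
next
  case (seq l P1 w1 t1 l1 P2 w2 t2 l2)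
  have "resolve ex = Some (b + length P1)" if "l1 = Some ex" for ex
    using assembled_first_label[OF seq.hyps(2)] seq.prems(1) that placed_first_label by auto
  then have 1: "i \<in> {b..<b + length P1} \<Longrightarrow> succs i \<subseteq> {b..b + length P1}"
    using seq.IH(1)[of b i] seq.prems(1) by simp
  have 2: "i \<in> {b + length P1..<b + length (P1 @ P2)} \<Longrightarrow>
      succs i \<subseteq> {b + length P1..b + length (P1 @ P2)}"
    using seq.IH(2)[of "b + length P1" i] seq.prems(1,2) by (simp add: add.assoc)
  from seq.prems(3) show ?case
  proof (rule interval_cases[where b = "b + length P1"])
    assume "i \<in> {b..<b + length P1}"
    then show ?thesis using 1 by auto
  next
    assume "i \<in> {b + length P1..<b + length (P1 @ P2)}"
    then show ?thesis using 2 by auto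
  qed
next
  case (branch Is w P1 w1 t1 l1 P2 w2 t2 l2 r m1 m2 t l br ex)
  have ne: "P1 \<noteq> []" "P2 \<noteq> []" "fst (hd P2) = None"
    using branch.hyps(2,3) assembled_first_label by blast+
  obtain b1 e1 b2 e2 where L:
    "b1 = b + length Is + 1" "e1 = b1 + length P1" "b2 = e1 + m1 + 1" "e2 = b2 + length P2"
    "b + length (if_code l Is br r P1 l1 m1 ex P2 l2 m2) = Suc (e2 + m2)"
    "placed (map (Pair None) Is) b" "code (b + length Is) = Some (Jz br r)"
    "placed P1 b1" "placed (map (Pair None) (replicate m1 Nop)) e1" "code (e1 + m1) = Some (Jmp ex)"
    "placed P2 b2" "placed (map (Pair None) (replicate m2 Nop)) e2" "code (e2 + m2) = Some Nop"
    "resolve br = Some b2" "\<And>l'. l1 = Some l' \<Longrightarrow> resolve l' = Some e1"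
    "\<And>l'. l2 = Some l' \<Longrightarrow> resolve l' = Some e2"
    by (rule placed_if_code[OF branch.prems(1) ne]) (rule that)
  have straight: "succs i = {Suc i}"
    if "placed (map (Pair None) Js) c" "i \<in> {c..<c + length Js}" "\<And>I. I \<in> set Js \<Longrightarrow> straight I" for Js c
    using placed_code[OF that(1), of i] that(2,3) succs_straight[of i] by auto
  have "i \<in> {b..<b + length Is} \<or> i = b + length Is \<or> i \<in> {b1..<e1} \<or> i \<in> {e1..<e1 + m1} \<or>
      i = e1 + m1 \<or> i \<in> {b2..<e2} \<or> i \<in> {e2..<e2 + m2} \<or> i = e2 + m2"
    using branch.prems(3) L(1-5) unfolding atLeastLessThan_iff by linarith
  then consider "i \<in> {b..<b + length Is}" | "i = b + length Is" | "i \<in> {b1..<e1}" | "i \<in> {e1..<e1 + m1}"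
    | "i = e1 + m1" | "i \<in> {b2..<e2}" | "i \<in> {e2..<e2 + m2}" | "i = e2 + m2"
    by blast
  then show ?case
  proof cases
    case 1
    with straight[OF L(6)] branch.hyps(1) L(1-5) show ?thesis by auto
  next
    case 2
    then show ?thesis using L(1-5,7,14) by (auto simp: succs_def)
  next
    case 3
    then have "succs i \<subseteq> {b1..e1}"
      using branch.IH(1)[OF L(8), of i] L(2,15) by auto
    then show ?thesis using L(1-5) by auto
  next
    case 4
    with straight[OF L(9)] L(1-5) show ?thesis by auto
  next
    case 5
    moreover have "resolve ex = None \<or> resolve ex = Some (Suc (e2 + m2))"
      using branch.prems(2)[of ex] L(5) by (cases "resolve ex") auto
    ultimately show ?thesis using L(1-5,10) by (auto simp: succs_def)
  next
    case 6
    then have "succs i \<subseteq> {b2..e2}"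
      using branch.IH(2)[OF L(11), of i] L(4,16) by auto
    then show ?thesis using L(1-5) by auto
  next
    case 7
    with straight[OF L(12)] L(1-5) show ?thesis by auto
  next
    case 8
    then show ?thesis using L(1-5,13) by (auto simp: succs_def)
  qed
next
  case (loop r x P w t l' l lp ex)
  obtain b1 e1 where L: "b1 = b + 3" "e1 = b1 + length P"
    "b + length (while_code l r (v2p x) lp ex P l') = e1 + 3"
    "code b = Some (Load r (v2p x))" "code (b + 1) = Some (Store (v2p x) r)" "code (b + 2) = Some (Jz ex r)"
    "placed P b1" "code e1 = Some (Load r (v2p x))" "code (e1 + 1) = Some (Store (v2p x) r)"
    "code (e1 + 2) = Some (Jmp lp)" "resolve lp = Some (b + 2)"
    "\<And>x. l' = Some x \<Longrightarrow> resolve x = Some e1"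
    by (rule placed_while_code[OF loop.prems(1)]) (rule that)
  have "i = b \<or> i = b + 1 \<or> i = b + 2 \<or> i \<in> {b1..<e1} \<or>
      i = e1 \<or> i = e1 + 1 \<or> i = e1 + 2"
    using loop.prems(3) L(1-3) unfolding atLeastLessThan_iff by linarith
  then consider "i = b" | "i = b + 1" | "i = b + 2" | "i \<in> {b1..<e1}" | "i = e1" | "i = e1 + 1" | "i = e1 + 2"
    by blast
  then show ?case
  proof cases
    case 3
    moreover have "resolve ex = None \<or> resolve ex = Some (e1 + 3)"
      using loop.prems(2)[of ex] L(3) by (cases "resolve ex") auto
    ultimately show ?thesis using L(1-3,6) by (auto simp: succs_def)
  next
    case 4
    then have "succs i \<subseteq> {b1..e1}"
      using loop.IH[OF L(7), of i] L(2,12) by auto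
    then show ?thesis using L(1-3) by auto
  qed (use L(1-5,8-11) in \<open>simp_all add: succs_def\<close>)
qed

text \<open>Coinduction with the closed interval as invariant: \<open>assembled_succs\<close> keeps
  control inside it, and the write effect makes all its instructions high. Only the end point relies
  on the assumption about the code behind.\<close>

lemma assembled_silent:
  assumes "assembled l P (Wr Hi) t l'" "placed P b"
    "\<And>ex e. l' = Some ex \<Longrightarrow> resolve ex = Some e \<Longrightarrow> e = b + length P"
    "silent (b + length P)" "i \<in> {b..b + length P}"
  shows "silent i"
  using assms(5)
proof (coinduction arbitrary: i)
  case silent
  show ?case
  proof (cases "i = b + length P")
    case True
    then show ?thesis
      using assms(4) by (auto elim: silent.cases)
  next
    case False
    then have i: "i \<in> {b..<b + length P}"
      using silent by auto
    obtain I where "code i = Some I" "typed (Wr Hi) I"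
      using placed_code[OF assms(2) i] assembled_typed[OF assms(1)] by blast
    moreover have "succs i \<subseteq> {b..b + length P}"
      by (rule assembled_succs[OF assms(1,2) _ i]) (rule assms(3))
    ultimately show ?thesis
      by (auto simp: typed_def)
  qed
qed

text \<open>A numeric timing arises only from high blocks, their sequences and balanced
  conditionals, never from a loop, so the steps can be counted. The exit label has to be resolved,
  for otherwise the jump to it would get stuck.\<close>

lemma assembled_timed:
  assumes "assembled l P w (Trm n) l'" "placed P b" "\<And>ex. l' = Some ex \<Longrightarrow> resolve ex = Some (b + length P)"
  shows "timed n (b + length P) b"
proof -
  have "timed n (b + length P) b" if "assembled l P w t l'" "t = Trm n" "placed P b"
    "\<And>ex. l' = Some ex \<Longrightarrow> resolve ex = Some (b + length P)" for l P w t l' n b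
    using that
  proof (induction arbitrary: n b rule: assembled.induct)
    case (block Is w t l)
    then show ?case
      using timed_straight[of Is b] by (auto simp: placed_block typed_def)
  next
    case (seq l P1 w1 t1 l1 P2 w2 t2 l2)
    obtain n1 n2 where n: "t1 = Trm n1" "t2 = Trm n2" "n = n1 + n2"
      using seq.prems(1) by (cases t1; cases t2) (auto simp: tjoin_def split: if_splits)
    have "resolve ex = Some (b + length P1)" if "l1 = Some ex" for ex
      using assembled_first_label[OF seq.hyps(2)] seq.prems(2) that placed_first_label by auto
    then show ?case
      using timed_trans[OF seq.IH(1)[OF n(1), of b] seq.IH(2)[OF n(2), of "b + length P1"]] seq.prems(2,3) n(3)
      by (simp add: add.assoc)
  next
    case (branch Is w P1 w1 t1 l1 P2 w2 t2 l2 r m1 m2 t l br ex)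
    \<comment> \<open>The outer \<open>Suc\<close> counts the \<open>Jz\<close>, the inner one the
      closing \<open>Jmp ex\<close> or, in the other branch, the closing \<open>Nop\<close>.\<close>
    then obtain n1 n2 where n: "t1 = Trm n1" "t2 = Trm n2" "n1 + m1 = n2 + m2" "w = Wr Hi"
      "n = length Is + Suc (n1 + Suc m1)"
      by auto
    have ne: "P1 \<noteq> []" "P2 \<noteq> []" "fst (hd P2) = None"
      using branch.hyps(2,3) assembled_first_label by blast+
    obtain b1 e1 b2 e2 where L:
      "b1 = b + length Is + 1" "e1 = b1 + length P1" "b2 = e1 + m1 + 1" "e2 = b2 + length P2"
      "b + length (if_code l Is br r P1 l1 m1 ex P2 l2 m2) = Suc (e2 + m2)"
      "placed (map (Pair None) Is) b" "code (b + length Is) = Some (Jz br r)"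
      "placed P1 b1" "placed (map (Pair None) (replicate m1 Nop)) e1" "code (e1 + m1) = Some (Jmp ex)"
      "placed P2 b2" "placed (map (Pair None) (replicate m2 Nop)) e2" "code (e2 + m2) = Some Nop"
      "resolve br = Some b2" "\<And>l'. l1 = Some l' \<Longrightarrow> resolve l' = Some e1"
      "\<And>l'. l2 = Some l' \<Longrightarrow> resolve l' = Some e2"
      by (rule placed_if_code[OF branch.prems(2) ne]) (rule that)
    let ?e = "b + length (if_code l Is br r P1 l1 m1 ex P2 l2 m2)"
    have "timed 1 ?e (e1 + m1)"
      using L(10) branch.prems(3) by (simp add: succs_def timed.simps(2))
    then have "timed (m1 + 1) ?e e1"
      by (rule timed_nops[OF L(9)])
    then have 1: "timed (n1 + (m1 + 1)) ?e b1"
      using timed_trans branch.IH(1)[OF n(1) L(8)] L(2,15) by blast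
    have "timed 1 ?e (e2 + m2)"
      using L(13) branch.prems(3) L(5) by (simp add: succs_def timed.simps(2))
    then have "timed (m2 + 1) ?e e2"
      by (rule timed_nops[OF L(12)])
    then have "timed (n2 + (m2 + 1)) ?e b2"
      using timed_trans branch.IH(2)[OF n(2) L(11)] L(4,16) by blast
    then have "timed (n1 + (m1 + 1)) ?e b2"
      using n(3) by simp
    with 1 have "timed (Suc (n1 + (m1 + 1))) ?e (b + length Is)"
      using L(1,7,14) by (simp add: succs_def timed.simps(2))
    moreover have "timed (length Is) (b + length Is) b"
      using timed_straight[OF L(6)] branch.hyps(1) n(4) by (simp add: typed_def)
    ultimately have "timed (length Is + Suc (n1 + (m1 + 1))) ?e b"
      by (rule timed_trans[rotated])
    then show ?case
      using n(5) by simp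
  qed auto
  with assms show ?thesis by blast
qed

text \<open>
  The exit label is unresolved only for the program as a whole, where jumping to it means getting
  stuck. In particular a final balanced conditional need not be timed, but then it is silent.
\<close>

lemma assembled_joins:
  assumes "assembled l P w t l'" "placed P b"
    "\<And>ex. l' = Some ex \<Longrightarrow> resolve ex = Some (b + length P) \<or> resolve ex = None \<and> silent (b + length P)"
    "t = Trm_Level Hi \<Longrightarrow> silent (b + length P)"
    "i \<in> {b..<b + length P}"
  shows "joins i"
  using assms
proof (induction arbitrary: b i rule: assembled.induct)
  case (block Is w t l)
  then have "code i = Some (Is ! (i - b))" "straight (Is ! (i - b))"
    using placed_unlabelled[of Is b] by (auto simp: placed_block dest: spec[of _ "i - b"])
  then show ?case
    by (rule joins_straight)
next
  case (seq l P1 w1 t1 l1 P2 w2 t2 l2)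
  let ?m = "b + length P1"
  have res: "resolve ex = Some ?m" if "l1 = Some ex" for ex
    using assembled_first_label[OF seq.hyps(2)] seq.prems(1) that placed_first_label by auto
  \<comment> \<open>High timing of the first command makes the second one high and the timing of the
    whole sequence high; silence of the code behind the sequence therefore extends back over
    \<open>P2\<close>.\<close>
  have sil: "silent ?m" if t1: "t1 = Trm_Level Hi"
  proof (rule assembled_silent)
    show "assembled l1 P2 (Wr Hi) t2 l2"
      using seq.hyps(2,3) t1 by simp
    show "silent (?m + length P2)"
      using seq.prems(3) t1 unfolding tplus_eq_Hi by (simp add: add.assoc)
  qed (use seq.prems in \<open>auto simp: add.assoc\<close>)
  from seq.prems(4) show ?case
  proof (rule interval_cases[where b = ?m])
    show "i \<in> {b..<?m} \<Longrightarrow> joins i"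
      using seq.IH(1)[of b i] seq.prems(1) res sil by simp
    show "i \<in> {?m..<b + length (P1 @ P2)} \<Longrightarrow> joins i"
      using seq.IH(2)[of ?m i] seq.prems(1-3) by (simp add: add.assoc tplus_eq_Hi)
  qed
next
  case (branch Is w P1 w1 t1 l1 P2 w2 t2 l2 r m1 m2 t l br ex)
  let ?P = "if_code l Is br r P1 l1 m1 ex P2 l2 m2"
  let ?e = "b + length ?P"
  have all: "assembled l ?P w t (Some ex)"
    by (rule assembled.branch[OF branch.hyps])
  show ?case
  \<comment> \<open>High code in front of a silent exit is silent as a whole, whether or not its
    branches are balanced.\<close>
  proof (cases "w = Wr Hi \<and> silent ?e")
    case True
    have exit: "e = ?e" if "Some ex = Some ex'" "resolve ex' = Some e" for ex' e
      using branch.prems(2)[of ex'] that by auto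
    have "silent i"
      by (rule assembled_silent[OF _ branch.prems(1) exit]) (use True all branch.prems(4) in auto)
    then show ?thesis
      by (simp add: joins_def)
  next
    case False
    have ne: "P1 \<noteq> []" "P2 \<noteq> []" "fst (hd P2) = None"
      using branch.hyps(2,3) assembled_first_label by blast+
    obtain b1 e1 b2 e2 where L:
      "b1 = b + length Is + 1" "e1 = b1 + length P1" "b2 = e1 + m1 + 1" "e2 = b2 + length P2"
      "?e = Suc (e2 + m2)"
      "placed (map (Pair None) Is) b" "code (b + length Is) = Some (Jz br r)"
      "placed P1 b1" "placed (map (Pair None) (replicate m1 Nop)) e1" "code (e1 + m1) = Some (Jmp ex)"
      "placed P2 b2" "placed (map (Pair None) (replicate m2 Nop)) e2" "code (e2 + m2) = Some Nop"
      "resolve br = Some b2" "\<And>l'. l1 = Some l' \<Longrightarrow> resolve l' = Some e1"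
      "\<And>l'. l2 = Some l' \<Longrightarrow> resolve l' = Some e2"
      by (rule placed_if_code[OF branch.prems(1) ne]) (rule that)
    have straight: "joins i"
      if "placed (map (Pair None) Js) c" "i \<in> {c..<c + length Js}" "\<And>I. I \<in> set Js \<Longrightarrow> straight I" for Js c
      using placed_code[OF that(1), of i] that(2,3) joins_straight by auto
    have timing: "t = Trm_Level Hi" if "t1 = Trm_Level Hi \<or> t2 = Trm_Level Hi"
      using branch.hyps(7) that by auto
    have "i \<in> {b..<b + length Is} \<or> i = b + length Is \<or> i \<in> {b1..<e1} \<or> i \<in> {e1..<e1 + m1} \<or>
        i = e1 + m1 \<or> i \<in> {b2..<e2} \<or> i \<in> {e2..<e2 + m2} \<or> i = e2 + m2"
      using branch.prems(4) L(1-5) unfolding atLeastLessThan_iff by linarith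
    then consider "i \<in> {b..<b + length Is}" | "i = b + length Is" | "i \<in> {b1..<e1}" | "i \<in> {e1..<e1 + m1}"
      | "i = e1 + m1" | "i \<in> {b2..<e2}" | "i \<in> {e2..<e2 + m2}" | "i = e2 + m2"
      by blast
    then show ?thesis
    proof cases
      case 1
      with straight[OF L(6)] branch.hyps(1) show ?thesis by auto
    next
      case 2
      show ?thesis
      proof (cases "rlev r = Hi")
        case True
        \<comment> \<open>An exit that is not silent forces a resolved exit label and a timing other
          than \<open>Trm_Level Hi\<close>; with a high test only the balanced alternative of
          \<open>assembled.branch\<close> is left.\<close>
        then have "w = Wr Hi" "\<not> silent ?e"
          using branch.hyps(6) False by auto
        then have ex: "resolve ex = Some ?e" and "t \<noteq> Trm_Level Hi"
          using branch.prems(2,3) by auto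
        then obtain n1 n2 where n: "t1 = Trm n1" "t2 = Trm n2" "n1 + m1 = n2 + m2"
          using branch.hyps(7) True by auto
        have "timed n1 e1 b1" "timed n2 e2 b2"
          using assembled_timed branch.hyps(2,3) n(1,2) L(2,4,8,11,15,16) by blast+
        moreover have "timed 1 ?e (e1 + m1)"
          using L(10) ex by (simp add: succs_def timed.simps(2))
        then have "timed (m1 + 1) ?e e1"
          by (rule timed_nops[OF L(9)])
        moreover have "timed 1 ?e (e2 + m2)"
          using L(5,13) by (simp add: succs_def timed.simps(2))
        then have "timed (m2 + 1) ?e e2"
          by (rule timed_nops[OF L(12)])
        ultimately have "timed (n1 + (m1 + 1)) ?e b1" "timed (n2 + (m2 + 1)) ?e b2"
          using timed_trans by blast+
        then have "timed (n1 + (m1 + 1)) ?e b1" "timed (n1 + (m1 + 1)) ?e b2"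
          using n(3) by simp_all
        then have "timed (Suc (n1 + (m1 + 1))) ?e i"
          using 2 L(1,7,14) by (simp add: succs_def timed.simps(2))
        then show ?thesis
          unfolding joins_def by blast
      qed (use 2 L(7) in \<open>auto simp: joins_def\<close>)
    next
      case 3
      \<comment> \<open>Between the end of the branch and the silent exit lie only padding and a
        jump.\<close>
      have "silent e1" if "t1 = Trm_Level Hi"
      proof -
        have e: "silent ?e"
          using branch.prems(3) timing that by blast
        then have "silent (e1 + m1)"
          by (intro silent.intros[of "e1 + m1"]) (use L(10) branch.prems(2) in \<open>auto simp: succs_def\<close>)
        then show ?thesis
          using silent_straight[OF L(9)] by simp
      qed
      then show ?thesis
        using branch.IH(1)[OF L(8), of i] 3 L(2,15) by blast
    next
      case 4
      with straight[OF L(9)] show ?thesis by auto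
    next
      case 5
      then show ?thesis using L(10) by (simp add: joins_def)
    next
      case 6
      have "silent e2" if "t2 = Trm_Level Hi"
      proof -
        have e: "silent ?e"
          using branch.prems(3) timing that by blast
        then have "silent (e2 + m2)"
          by (intro silent.intros[of "e2 + m2"]) (use L(5,13) in \<open>auto simp: succs_def\<close>)
        then show ?thesis
          using silent_straight[OF L(12)] by simp
      qed
      then show ?thesis
        using branch.IH(2)[OF L(11), of i] 6 L(4,16) by blast
    next
      case 7
      with straight[OF L(12)] show ?thesis by auto
    next
      case 8
      then show ?thesis using L(13) by (simp add: joins_def)
    qed
  qed
next
  case (loop r x P w t l' l lp ex)
  let ?P = "while_code l r (v2p x) lp ex P l'"
  have all: "assembled l ?P (Wr (rlev r)) (Trm_Level (rlev r)) (Some ex)"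
    by (rule assembled.loop[OF loop.hyps])
  show ?case
  \<comment> \<open>A loop with a high test is high code of timing \<open>Trm_Level Hi\<close>,
    hence followed by silent code only. With a low test the \<open>Jz\<close> is harmless and the
    body does not have that timing.\<close>
  proof (cases "rlev r = Hi")
    case True
    have exit: "e = b + length ?P" if "Some ex = Some ex'" "resolve ex' = Some e" for ex' e
      using loop.prems(2)[of ex'] that by auto
    have "silent i"
      by (rule assembled_silent[OF _ loop.prems(1) exit]) (use True all loop.prems(3,4) in auto)
    then show ?thesis
      by (simp add: joins_def)
  next
    case False
    then have t: "t \<noteq> Trm_Level Hi"
      using loop.hyps(4) by simp
    obtain b1 e1 where L: "b1 = b + 3" "e1 = b1 + length P" "b + length ?P = e1 + 3"
      "code b = Some (Load r (v2p x))" "code (b + 1) = Some (Store (v2p x) r)" "code (b + 2) = Some (Jz ex r)"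
      "placed P b1" "code e1 = Some (Load r (v2p x))" "code (e1 + 1) = Some (Store (v2p x) r)"
      "code (e1 + 2) = Some (Jmp lp)" "resolve lp = Some (b + 2)"
      "\<And>x. l' = Some x \<Longrightarrow> resolve x = Some e1"
      by (rule placed_while_code[OF loop.prems(1)]) (rule that)
    have "i = b \<or> i = b + 1 \<or> i = b + 2 \<or> i \<in> {b1..<e1} \<or>
        i = e1 \<or> i = e1 + 1 \<or> i = e1 + 2"
      using loop.prems(4) L(1-3) unfolding atLeastLessThan_iff by linarith
    then consider "i = b" | "i = b + 1" | "i = b + 2" | "i \<in> {b1..<e1}" | "i = e1" | "i = e1 + 1" | "i = e1 + 2"
      by blast
    then show ?thesis
    proof cases
      case 4
      then show ?thesis
        using loop.IH[OF L(7), of i] L(2,12) t by blast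
    qed (use L(4-6,8-10) False in \<open>simp_all add: joins_def\<close>)
  qed
qed

end

section \<open>Related runs\<close>

lemma compile_com_distinct_labels:
  "compile_com v2p vlev rlev U \<Phi> l C P wt l' \<Phi>' U' \<Longrightarrow> distinct_labels P"
proof (induction rule: compile_com.induct)
  case (skip U \<Phi> l)
  then show ?case
    by (cases l) (auto simp: distinct_labels_def)
qed auto

text \<open>The successor of the last position is \<open>length P\<close>; the strict bound keeps it
  from wrapping around to \<open>0\<close>.\<close>

locale short_program = security_levels v2p vlev rlev
  for v2p :: "'v \<Rightarrow> 'w::len word" and vlev :: "'v \<Rightarrow> level" and rlev :: "'r \<Rightarrow> level" +
  fixes P :: "('r, 'l, 'w word) program"
  assumes short: "length P < 2 ^ LENGTH('w)"
begin

section \<open>Positions as numbers and as words\<close>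

definition code :: "nat \<Rightarrow> ('r, 'l, 'w word) instr option" where
  "code i = (if i < length P then Some (snd (P ! i)) else None)"

definition resolve :: "'l \<Rightarrow> nat option" where
  "resolve l = (if \<exists>i<length P. fst (P ! i) = Some l
    then Some (LEAST i. i < length P \<and> fst (P ! i) = Some l) else None)"

sublocale code_memory v2p vlev rlev code resolve ..

lemma fetch_code: "fetch P pc = code (unat pc)"
  by (simp add: fetch_def code_def)

lemma res_resolve: "res P l = map_option word_of_nat (resolve l)"
  by (simp add: res_def resolve_def)

lemma unat_res: "res P l = Some pc \<Longrightarrow> resolve l = Some (unat pc)"
proof -
  assume res: "res P l = Some pc"
  then obtain i where i: "resolve l = Some i" "pc = word_of_nat i"
    by (auto simp: res_resolve)
  then have "i < length P"
    using LeastI_ex[of "\<lambda>i. i < length P \<and> fst (P ! i) = Some l"]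
    by (auto simp: resolve_def split: if_splits)
  then show ?thesis
    using i short by (simp add: unat_of_nat)
qed

lemma unat_Suc: "code (unat pc) = Some I \<Longrightarrow> unat (pc + 1) = Suc (unat pc)" for pc :: "'w word"
  using short by (simp add: code_def unat_word_ariths split: if_splits)

text \<open>Distinct labels make the position chosen by \<open>LEAST\<close> the only one that
  carries the label.\<close>

lemma placed_program: "distinct_labels P \<Longrightarrow> placed P 0"
  unfolding placed_def
proof (intro allI impI conjI)
  fix i l
  assume d: "distinct_labels P" and i: "i < length P" "fst (P ! i) = Some l"
  then have "(LEAST j. j < length P \<and> fst (P ! j) = Some l) = i"
    by (intro Least_equality) (auto dest: distinct_labels_nth)
  then show "resolve l = Some (0 + i)"
    using i by (auto simp: resolve_def)
qed (simp add: code_def)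

section \<open>Single steps from low-equal states\<close>

lemma low_eq_iff:
  "low_eq v2p vlev rlev (R, M) (R', M') \<longleftrightarrow>
    (\<forall>r. rlev r = Lo \<longrightarrow> R r = R' r) \<and> (\<forall>k\<in>low_cells. M k = M' k)"
  by (auto simp: low_eq_def low_cells_def)

lemma low_eq_sym: "low_eq v2p vlev rlev m m' \<Longrightarrow> low_eq v2p vlev rlev m' m"
  by (cases m; cases m') (auto simp: low_eq_iff)

lemma low_eq_trans:
  "low_eq v2p vlev rlev m m' \<Longrightarrow> low_eq v2p vlev rlev m' m'' \<Longrightarrow> low_eq v2p vlev rlev m m''"
  by (cases m; cases m'; cases m'') (auto simp: low_eq_iff)

lemma fst_flip [simp]: "fst (flip s L) = fst s"
  by (cases s) auto

text \<open>The same bits are negated in both states, so words that agreed still agree.\<close>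

lemma low_eq_flip: "low_eq v2p vlev rlev (snd s) (snd s') \<Longrightarrow> low_eq v2p vlev rlev (snd (flip s L)) (snd (flip s' L))"
  by (cases s; cases s') (auto simp: low_eq_iff)

lemma step_iff:
  "step P (pc, R, M) a s' \<longleftrightarrow> (case code (unat pc) of
      None \<Rightarrow> False
    | Some I \<Rightarrow> (case I of
        Load r k \<Rightarrow> a = Tau \<and> s' = (pc + 1, R(r := M k), M)
      | Store k r \<Rightarrow> a = Tau \<and> s' = (pc + 1, R, M(k := R r))
      | Jmp l \<Rightarrow> a = Tau \<and> (\<exists>pc'. res P l = Some pc' \<and> s' = (pc', R, M))
      | Jz l r \<Rightarrow> a = Tau \<and>
          (if R r = 0 then \<exists>pc'. res P l = Some pc' \<and> s' = (pc', R, M) else s' = (pc + 1, R, M))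
      | Nop \<Rightarrow> a = Tau \<and> s' = (pc + 1, R, M)
      | Movek r k \<Rightarrow> a = Tau \<and> s' = (pc + 1, R(r := k), M)
      | Mover r r' \<Rightarrow> a = Tau \<and> s' = (pc + 1, R(r := R r'), M)
      | Op f r r' \<Rightarrow> a = Tau \<and> s' = (pc + 1, R(r := f (R r) (R r')), M)
      | Output ch r \<Rightarrow> a = Out ch (R r) \<and> s' = (pc + 1, R, M)))"
  (is "?lhs \<longleftrightarrow> ?rhs")
proof
  assume ?lhs
  then show ?rhs
    by cases (auto simp flip: fetch_code)
next
  assume ?rhs
  then show ?lhs
    by (auto simp flip: fetch_code intro: step.intros split: option.splits instr.splits if_splits)
qed

lemma step_code:
  assumes "step P s a s'"
  shows "\<exists>I. code (unat (fst s)) = Some I \<and> unat (fst s') \<in> succs (unat (fst s))"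
  using assms by cases (auto simp: fetch_code succs_def unat_Suc dest: unat_res)

lemma step_high:
  assumes "step P s a s'" "code (unat (fst s)) = Some I" "high I"
  shows "low a = Tau \<and> low_eq v2p vlev rlev (snd s) (snd s')"
  using assms by cases (auto simp: fetch_code low_eq_iff)

text \<open>By \<open>flow\<close>, what a step writes at the low level or sends on the low channel
  is computed from low data, and a \<open>Jz\<close> on a low register takes the same branch in both
  states.\<close>

lemma step_flow:
  assumes "step P s a s'" "step P u b u'" "fst s = fst u" "low_eq v2p vlev rlev (snd s) (snd u)"
    "code (unat (fst s)) = Some I" "flow I" "\<And>l r. I = Jz l r \<Longrightarrow> rlev r = Lo"
  shows "low a = low b \<and> fst s' = fst u' \<and> low_eq v2p vlev rlev (snd s') (snd u')"
proof -
  obtain pc R M R' M' where s: "s = (pc, R, M)" and u: "u = (pc, R', M')"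
    using assms(3) by (cases s; cases u) auto
  show ?thesis
  proof (cases I)
    case (Output ch r)
    then show ?thesis
      using assms(1,2,4-6) unfolding s u by (cases ch) (auto simp: step_iff low_eq_iff)
  next
    case (Jz l r)
    then have "R r = R' r"
      using assms(4,7) unfolding s u by (auto simp: low_eq_iff)
    then show ?thesis
      using Jz assms(1,2,4-6) unfolding s u by (auto simp: step_iff split: if_splits)
  qed (use assms(1,2,4-6) in \<open>unfold s u, auto simp: step_iff low_eq_iff\<close>)
qed

section \<open>Stuckness and faulty steps\<close>

lemma step_not_stuck: "step P s a s' \<Longrightarrow> \<not> stuck P s"
  unfolding stuck_def by blast

text \<open>An unresolved label blocks, except for a \<open>Jz\<close> whose register is nonzero:
  this is the only way in which data influence stuckness.\<close>

lemma not_stuck_iff: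
  "\<not> stuck P (pc, R, M) \<longleftrightarrow> (\<exists>I. code (unat pc) = Some I \<and>
    (resolved I \<or> (\<exists>l r. I = Jz l r \<and> R r \<noteq> 0)))"
proof (cases "code (unat pc)")
  case (Some I)
  show ?thesis
  proof (cases I)
    case (Jz l r)
    then show ?thesis
      using Some by (cases "R r = 0") (auto simp: stuck_def step_iff res_resolve)
  qed (use Some in \<open>auto simp: stuck_def step_iff res_resolve\<close>)
qed (simp add: stuck_def step_iff)

lemma not_stuck_resolved: "code (unat (fst s)) = Some I \<Longrightarrow> resolved I \<Longrightarrow> \<not> stuck P s"
  by (cases s) (simp add: not_stuck_iff)

text \<open>By \<open>not_stuck_iff\<close> the only relevant datum is the register tested by a
  \<open>Jz\<close>, and it is low here, so both states agree on it.\<close>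

lemma stuck_cong:
  assumes "fst s = fst u" "low_eq v2p vlev rlev (snd s) (snd u)"
    "\<And>l r. code (unat (fst s)) = Some (Jz l r) \<Longrightarrow> rlev r = Lo"
  shows "stuck P s \<longleftrightarrow> stuck P u"
proof -
  obtain pc R M R' M' where "s = (pc, R, M)" "u = (pc, R', M')"
    using assms(1) by (cases s; cases u) auto
  with assms(2,3) have "\<not> stuck P s \<longleftrightarrow> \<not> stuck P u"
    unfolding not_stuck_iff by (auto simp: not_stuck_iff low_eq_iff)
  then show ?thesis by blast
qed

text \<open>Lets the second run answer each step of the first with the same fault set.\<close>

lemma aug_step_total: "L \<subseteq> faulty \<Longrightarrow> \<exists>a s'. aug_step P s L a s'"
  by (metis aug_step.intros stuck_def)

lemma aug_step_faulty: "aug_step P s L a s' \<Longrightarrow> L \<subseteq> faulty"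
  by (auto elim: aug_step.cases)

lemma aug_step_silent:
  assumes "aug_step P s L a s'" "silent (unat (fst s))"
  shows "low a = Tau \<and> silent (unat (fst s'))"
  using assms(1)
proof cases
  case normal
  then show ?thesis
    using step_code[of "flip s L" a s'] step_high[of "flip s L" a s'] assms(2)
    by (auto elim: silent.cases)
qed (use assms(2) in auto)

text \<open>Resolved labels keep the state from being stuck before and after the flip, so the step
  does take place on \<open>flip s L\<close>. The new low part is compared with that of
  \<open>flip s L\<close>, since the fault itself may change low bits.\<close>

lemma aug_step_timed:
  assumes "aug_step P s L a s'" "timed (Suc n) e (unat (fst s))"
  shows "low a = Tau \<and> timed n e (unat (fst s')) \<and> low_eq v2p vlev rlev (snd (flip s L)) (snd s')"
proof -
  obtain I where I: "code (unat (fst s)) = Some I" "high I" "resolved I"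
    "\<And>j. j \<in> succs (unat (fst s)) \<Longrightarrow> timed n e j"
    using assms(2) by (auto simp: timed.simps(2))
  have "\<not> stuck P s" "\<not> stuck P (flip s L)"
    using I not_stuck_resolved by auto
  with assms(1) have "step P (flip s L) a s'"
    by (auto elim: aug_step.cases)
  then show ?thesis
    using step_code[of "flip s L" a s'] step_high[of "flip s L" a s'] I by auto
qed

text \<open>
  In the silent case low equality is not preserved: one state may be stuck, and hence immune to faults,
  while the other is not.
\<close>

definition related :: "('r, 'w) state \<Rightarrow> ('r, 'w) state \<Rightarrow> bool" where
  "related s u \<longleftrightarrow> silent (unat (fst s)) \<and> silent (unat (fst u)) \<or>
    low_eq v2p vlev rlev (snd s) (snd u) \<and>
      (\<exists>n e. fst s = fst u \<or> timed n e (unat (fst s)) \<and> timed n e (unat (fst u)))"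

lemma related_sym: "related s u \<Longrightarrow> related u s"
  unfolding related_def using low_eq_sym by metis

text \<open>At a common position, instructions other than a \<open>Jz\<close> on a high register are
  covered by \<open>step_flow\<close> and \<open>stuck_cong\<close>; for such a \<open>Jz\<close>,
  \<open>joins\<close> puts both runs into the silent or the timed case.\<close>

lemma related_step:
  assumes "\<And>i I. code i = Some I \<Longrightarrow> flow I \<and> joins i"
    and "related s u" "aug_step P s L a s'" "aug_step P u L b u'"
  shows "low a = low b \<and> related s' u'"
proof -
  have timed_case: ?thesis if "low_eq v2p vlev rlev (snd s) (snd u)"
    "timed (Suc n) e (unat (fst s))" "timed (Suc n) e (unat (fst u))" for n e
  proof -
    note s = aug_step_timed[OF assms(3) that(2)] and u = aug_step_timed[OF assms(4) that(3)]
    \<comment> \<open>Chain of low equalities from \<open>s'\<close> through \<open>flip s L\<close>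
      and \<open>flip u L\<close> to \<open>u'\<close>: the high steps change nothing low, and the
      fault is common to both runs.\<close>
    have "low_eq v2p vlev rlev (snd s') (snd (flip u L))"
      by (rule low_eq_trans[OF low_eq_sym low_eq_flip[OF that(1)]]) (use s in blast)
    then have "low_eq v2p vlev rlev (snd s') (snd u')"
      by (rule low_eq_trans) (use u in blast)
    then show ?thesis
      using s u unfolding related_def by metis
  qed
  have silent_case: ?thesis if "silent (unat (fst s))" "silent (unat (fst u))"
    using aug_step_silent[OF assms(3) that(1)] aug_step_silent[OF assms(4) that(2)]
    by (simp add: related_def)
  have same_case: ?thesis if eq: "fst s = fst u" and low: "low_eq v2p vlev rlev (snd s) (snd u)"
  proof (cases "\<exists>l r. code (unat (fst s)) = Some (Jz l r) \<and> rlev r = Hi")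
    case True
    then have "silent (unat (fst s)) \<or> (\<exists>n e. timed (Suc n) e (unat (fst s)))"
      using assms(1)[of "unat (fst s)"] unfolding joins_def by blast
    then show ?thesis
    proof (elim disjE exE)
      assume "silent (unat (fst s))"
      then show ?thesis
        using silent_case eq by simp
    next
      fix n e
      assume "timed (Suc n) e (unat (fst s))"
      then show ?thesis
        using timed_case low eq by simp
    qed
  next
    case False
    then have jz: "\<And>l r. code (unat (fst s)) = Some (Jz l r) \<Longrightarrow> rlev r = Lo"
      by auto
    have stuck_eq: "stuck P s \<longleftrightarrow> stuck P u"
      by (rule stuck_cong[OF eq low jz])
    have stuck_flip_eq: "stuck P (flip s L) \<longleftrightarrow> stuck P (flip u L)"
      by (rule stuck_cong[OF _ low_eq_flip[OF low]]) (simp_all add: eq jz)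
    from assms(3) show ?thesis
    proof cases
      case normal
      have "\<not> stuck P u" "\<not> stuck P (flip u L)"
        using normal(2) stuck_eq step_not_stuck[OF normal(3)] stuck_flip_eq by simp_all
      with assms(4) have u: "step P (flip u L) b u'"
        by cases auto
      obtain I where I: "code (unat (fst (flip s L))) = Some I"
        using step_code[OF normal(3)] by blast
      have "low a = low b \<and> fst s' = fst u' \<and> low_eq v2p vlev rlev (snd s') (snd u')"
      proof (rule step_flow[OF normal(3) u _ low_eq_flip[OF low] I])
        show "flow I"
          using assms(1) I by blast
        show "rlev r = Lo" if "I = Jz l r" for l r
          using jz I that by simp
      qed (simp add: eq)
      then show ?thesis
        by (simp add: related_def)
    next
      case fault_stuck
      have "\<not> stuck P u" and su: "stuck P (flip u L)"
        using fault_stuck stuck_eq stuck_flip_eq by simp_all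
      with assms(4) have "b = Tau \<and> u' = flip u L"
      proof cases
        case normal
        with su show ?thesis
          using step_not_stuck by blast
      qed auto
      then show ?thesis
        using fault_stuck eq low_eq_flip[OF low, of L] by (simp add: related_def)
    next
      case stuck
      with stuck_eq have "stuck P u"
        by blast
      with assms(4) have "b = Tau \<and> u' = u"
        by cases auto
      then show ?thesis
        using stuck eq low by (simp add: related_def)
    qed
  qed
  from assms(2)[unfolded related_def] show ?thesis
  proof (elim disjE conjE exE)
    fix n e
    assume timed: "low_eq v2p vlev rlev (snd s) (snd u)" "timed n e (unat (fst s))" "timed n e (unat (fst u))"
    show ?thesis
    proof (cases n)
      case 0
      \<comment> \<open>With no steps left both runs have arrived at \<open>e\<close>, and
        \<open>unat\<close> is injective.\<close>
      then have "fst s = fst u"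
        using timed by (simp add: word_eq_iff_unsigned[where ?'a = nat])
      with timed(1) show ?thesis
        by (rule same_case[rotated])
    next
      case (Suc m)
      then show ?thesis
        using timed_case timed by blast
    qed
  qed (rule silent_case same_case; assumption)+
qed

text \<open>The answering run suffers the same faults, and its actions agree with the given ones
  after \<open>low\<close>. Symmetry of \<open>related\<close> yields the converse
  direction.\<close>

lemma PoNI_if_joins:
  assumes "\<And>i I. code i = Some I \<Longrightarrow> flow I \<and> joins i"
  shows "PoNI v2p vlev rlev P"
proof -
  have run: "\<exists>bs u'. aug_run P u bs u' \<and> map (\<lambda>(L, a). (L, low a)) bs = map (\<lambda>(L, a). (L, low a)) as"
    if "aug_run P s as s'" "related s u" for s as s' u
    using that
  proof (induction arbitrary: u rule: aug_run.induct)
    case (empty s)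
    show ?case
      by (intro exI[of _ "[]"] exI[of _ u] conjI aug_run.empty refl)
  next
    case (step s L a s' as s'')
    obtain b u' where u: "aug_step P u L b u'"
      using aug_step_total[OF aug_step_faulty[OF step.hyps(1)], of u] by blast
    then have related: "low a = low b \<and> related s' u'"
      by (intro related_step[OF assms step.prems step.hyps(1)])
    then obtain bs u'' where "aug_run P u' bs u''"
      "map (\<lambda>(L, a). (L, low a)) bs = map (\<lambda>(L, a). (L, low a)) as"
      using step.IH[of u'] by blast
    with u related show ?case
      by (intro exI[of _ "(L, b) # bs"] exI[of _ u''] conjI aug_run.step) simp_all
  qed
  have "has_trace P u t" if trace: "has_trace P s t" and related: "related s u" for s u t
  proof -
    obtain as s' where "aug_run P s as s'" "t = map (\<lambda>(L, a). (L, low a)) as"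
      using trace unfolding has_trace_def by blast
    with run[OF this(1) related] show ?thesis
      unfolding has_trace_def by metis
  qed
  then have "has_trace P s t \<longleftrightarrow> has_trace P u t" if "related s u" for s u t
    using that related_sym by blast
  moreover have "related (0, R, M) (0, R', M')" if "low_eq v2p vlev rlev (R, M) (R', M')" for R M R' M'
    using that by (simp add: related_def)
  ultimately show ?thesis
    unfolding PoNI_def by blast
qed

end

theorem corollary1:
  fixes v2p :: "'v \<Rightarrow> 'w::len word"
    and vlev :: "'v \<Rightarrow> level"
    and rlev :: "'r \<Rightarrow> level"
    and C :: "('v, 'w word) com"
    and P :: "('r, 'l, 'w word) program"
    and w :: write_eff and t :: timing
    and l :: "'l option"
    and \<Phi> :: "('r, 'v) reg_record"
  assumes "inj v2p"
    and "length P < 2 ^ LENGTH('w)"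
    and "compiles v2p vlev rlev Map.empty None C P (w, t) l \<Phi>"
  shows "PoNI v2p vlev rlev P"
proof -
  interpret short_program v2p vlev rlev P
    by unfold_locales (use assms in auto)
  obtain U where C: "compile_com v2p vlev rlev {} Map.empty None C P (w, t) l \<Phi> U"
    using assms(3) by (auto simp: compiles_def)
  have assembled: "assembled None P w t l"
    using compile_com_assembled[OF C] by simp
  \<comment> \<open>For the program as a whole the exit label is unresolved and the position behind
    the last instruction is vacuously silent, which meets the hypotheses of
    \<open>assembled_joins\<close> for any timing \<open>t\<close>.\<close>
  have "resolve ex = None" if "l = Some ex" for ex
    using compile_com_labels[OF C] that by (auto simp: resolve_def in_labels_conv_nth)
  moreover have "silent (length P)"
    by (rule silent.intros) (auto simp: code_def succs_def)
  ultimately have "joins i" if "i < length P" for i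
    using assembled_joins[OF assembled placed_program, of i] compile_com_distinct_labels[OF C] that by auto
  moreover have "flow (snd (P ! i))" if "i < length P" for i
    using assembled_typed[OF assembled] that by (auto simp: typed_def)
  ultimately show ?thesis
    by (intro PoNI_if_joins) (metis code_def option.distinct(1) option.inject)
qed

end
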